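(* Let $K$ be a field, let $\Lambda=K\mathcal{Q}/I$ be the Brauer configuration algebra induced by a Brauer configuration $\Gamma=(\Gamma_0,\Gamma_1,\mu,\mathfrak{o})$, and let $V$ be a polygon of $\Gamma$ with $v$ its associated vertex in $\mathcal{Q}$. Then the length of the right $\Lambda$-module $v\Lambda$ is $$\ell(v\Lambda)=2+\sum_{\alpha\in\overline{V}}\mathrm{occ}(\alpha,V)\bigl(\mathrm{val}(\alpha)\mu(\alpha)-1\bigr).$$
   Context: $\ell(M)$ denotes the length (number of composition factors) of a module $M$; $v\Lambda$ is the indecomposable projective right module associated to the vertex $v$. Brauer configurations. A Brauer configuration is a quadruple $\Gamma=(\Gamma_0,\Gamma_1,\mu,\mathfrak{o})$ where: $\Gamma_0$ is a finite set (vertices); $\Gamma_1$ is a finite collection of finite labeled multisets of elements of $\Gamma_0$ (polygons; differently labeled polygons may have the same elements); $\mu:\Gamma_0\to\mathbb{Z}_{>0}$ is a function (multiplicity). For $\alpha\in\Gamma_0$, $V\in\Gamma_1$, $\mathrm{occ}(\alpha,V)$ is the number of times $\alpha$ occurs in $V$, and $\mathrm{val}(\alpha)=\sum_{V\in\Gamma_1}\mathrm{occ}(\alpha,V)$. A vertex $\alpha$ is truncated if $\mathrm{val}(\alpha)=\mu(\alpha)=1$. The orientation $\mathfrak{o}$ is a choice, for each nontruncated vertex $\alpha$, of a cyclic ordering $V_{i_1}<\cdots<V_{i_t}(<V_{i_1})$, $t=\mathrm{val}(\alpha)$, of the list of polygons containing $\alpha$, in which each $V$ appears $\mathrm{occ}(\alpha,V)$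 times (the successor sequence at $\alpha$). It is required that: (C1) every vertex occurs in at least one polygon; (C2) every polygon has at least two vertices (counted with repetition); (C3) every polygon contains a vertex $\alpha$ with $\mathrm{val}(\alpha)\mu(\alpha)>1$. $\overline{V}$ denotes the set of vertices occurring in $V$. Quiver and algebra. The quiver $\mathcal{Q}$ induced by $\Gamma$ has one vertex $v$ for each polygon $V$, and for each nontruncated $\alpha$ with successor sequence $V_{i_1}<\cdots<V_{i_t}$ it has $t$ arrows $a^{(\alpha)}_j:v_{i_j}\to v_{i_{j+1}}$ ($1\le j\le t$, $i_{t+1}=i_1$), all arrows for different $\alpha$ or different $j$ being distinct. Paths are written from left to right. The special $\alpha$-cycles are $C_l=a^{(\alpha)}_l\cdots a^{(\alpha)}_t a^{(\alpha)}_1\cdots a^{(\alpha)}_{l-1}$, $1\le l\le t$; those starting (and ending) at $v$ are the special $\alpha$-cycles at $v$. The Brauer configuration algebra is $\Lambda=K\mathcal{Q}/I$ where $I$ is generated by: (type one) $C^{\mu(\alpha)}-D^{\mu(\beta)}$ for every polygon $V$, all nontruncated $\alpha,\beta\in\overline{V}$, and all special $\alpha$-cycles $C$ and special $\beta$-cycles $D$ at $v$; (type two) $C^{\mu(\alpha)}f(C)$ for every nontruncated $\alpha$ and special $\alpha$-cycle $C$, where $f(C)$ is the first arrow of $C$; (type three) all paths $ab$ of length two that are not subpaths of any special cycle, except the squares $aa$ where $a$ is the loop induced by a vertex $\alpha$ with $\mathrm{val}(\alpha)=1$ and $\mu(\alpha)>1$. The vertex $v$ is also viewed as an idempotent of $\Lambda$.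 *)

theory Defs
  imports
    "HOL-Algebra.Module"
    "HOL-Algebra.QuotRing"
    "HOL-Library.Multiset"
    "HOL-Library.Sublist"
    "HOL-Library.Poly_Mapping"
    "HOL-Library.Extended_Nat"
    "Graph_Theory.Arc_Walk"
begin

(* otherwise it shadows the multiplication of HOL-Algebra's monoid record *)
hide_const (open) Multiset.mult

section \<open>Brauer configurations\<close>

text \<open>
  Polygons are labels of type \<open>'l\<close>; \<open>polygon \<Gamma> V\<close> is the multiset of vertices carried by the
  label \<open>V\<close>, so differently labelled polygons may carry the same multiset.  The cyclic ordering
  chosen at a nontruncated vertex is recorded by listing it from an arbitrary starting point;
  the values of \<open>successors\<close> and \<open>mu\<close> at all other arguments are irrelevant.
\<close>

record ('a, 'l) brauer_config =
  vertices :: "'a set"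
  polygons :: "'l set"
  polygon :: "'l \<Rightarrow> 'a multiset"
  mu :: "'a \<Rightarrow> nat"
  successors :: "'a \<Rightarrow> 'l list"

definition occ :: "('a, 'l) brauer_config \<Rightarrow> 'a \<Rightarrow> 'l \<Rightarrow> nat" where
  "occ \<Gamma> \<alpha> V = count (polygon \<Gamma> V) \<alpha>"

definition valence :: "('a, 'l) brauer_config \<Rightarrow> 'a \<Rightarrow> nat" where
  "valence \<Gamma> \<alpha> = (\<Sum>V\<in>polygons \<Gamma>. occ \<Gamma> \<alpha> V)"

definition truncated :: "('a, 'l) brauer_config \<Rightarrow> 'a \<Rightarrow> bool" where
  "truncated \<Gamma> \<alpha> \<longleftrightarrow> valence \<Gamma> \<alpha> = 1 \<and> mu \<Gamma> \<alpha> = 1"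

definition nontruncated :: "('a, 'l) brauer_config \<Rightarrow> 'a set" where
  "nontruncated \<Gamma> = {\<alpha> \<in> vertices \<Gamma>. \<not> truncated \<Gamma> \<alpha>}"

locale brauer_configuration =
  fixes \<Gamma> :: "('a, 'l) brauer_config"
  assumes finite_vertices: "finite (vertices \<Gamma>)"
    and finite_polygons: "finite (polygons \<Gamma>)"
    and polygon_vertices: "V \<in> polygons \<Gamma> \<Longrightarrow> set_mset (polygon \<Gamma> V) \<subseteq> vertices \<Gamma>"
    and mu_pos: "\<alpha> \<in> vertices \<Gamma> \<Longrightarrow> mu \<Gamma> \<alpha> > 0"
    and successors_polygons: "\<alpha> \<in> nontruncated \<Gamma> \<Longrightarrow> set (successors \<Gamma> \<alpha>) \<subseteq> polygons \<Gamma>"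
    and successors_occ: "\<alpha> \<in> nontruncated \<Gamma> \<Longrightarrow> V \<in> polygons \<Gamma> \<Longrightarrow>
      count_list (successors \<Gamma> \<alpha>) V = occ \<Gamma> \<alpha> V"
    and C1: "\<alpha> \<in> vertices \<Gamma> \<Longrightarrow> \<exists>V\<in>polygons \<Gamma>. \<alpha> \<in># polygon \<Gamma> V"
    and C2: "V \<in> polygons \<Gamma> \<Longrightarrow> size (polygon \<Gamma> V) \<ge> 2"
    and C3: "V \<in> polygons \<Gamma> \<Longrightarrow> \<exists>\<alpha>. \<alpha> \<in># polygon \<Gamma> V \<and> valence \<Gamma> \<alpha> * mu \<Gamma> \<alpha> > 1"


section \<open>The induced quiver\<close>

text \<open>
  The arrow \<open>(\<alpha>, j)\<close> is the one from the \<open>j\<close>-th entry of the successor sequence at \<open>\<alpha>\<close> to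
  the cyclically next one, counting from \<open>0\<close>.  The quiver vertex associated to a polygon is
  its label.
\<close>

definition quiver :: "('a, 'l) brauer_config \<Rightarrow> ('l, 'a \<times> nat) pre_digraph" where
  "quiver \<Gamma> = \<lparr>
     verts = polygons \<Gamma>,
     arcs = {(\<alpha>, j). \<alpha> \<in> nontruncated \<Gamma> \<and> j < valence \<Gamma> \<alpha>},
     tail = (\<lambda>(\<alpha>, j). successors \<Gamma> \<alpha> ! j),
     head = (\<lambda>(\<alpha>, j). successors \<Gamma> \<alpha> ! (Suc j mod valence \<Gamma> \<alpha>))\<rparr>"

definition special_cycles :: "('a, 'l) brauer_config \<Rightarrow> 'a \<Rightarrow> ('a \<times> nat) list set" where
  "special_cycles \<Gamma> \<alpha> =
     {rotate l (map (Pair \<alpha>) [0..<valence \<Gamma> \<alpha>]) | l. l < valence \<Gamma> \<alpha>}"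

definition special_cycles_at :: "('a, 'l) brauer_config \<Rightarrow> 'a \<Rightarrow> 'l \<Rightarrow> ('a \<times> nat) list set" where
  "special_cycles_at \<Gamma> \<alpha> V = {C \<in> special_cycles \<Gamma> \<alpha>. tail (quiver \<Gamma>) (hd C) = V}"


section \<open>Path algebras\<close>

text \<open>
  A path is a pair of its starting vertex and its list of arrows, read from left to right;
  \<open>(v, [])\<close> is the trivial path at \<open>v\<close>.
\<close>

type_synonym ('v, 'e) path = "'v \<times> 'e list"

definition paths :: "('v, 'e) pre_digraph \<Rightarrow> ('v, 'e) path set" where
  "paths G = {(u, p). \<exists>w. pre_digraph.awalk G u p w}"

definition path_end :: "('v, 'e) pre_digraph \<Rightarrow> ('v, 'e) path \<Rightarrow> 'v" where
  "path_end G p = last (pre_digraph.awalk_verts G (fst p) (snd p))"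

definition path_times ::
    "('v, 'e) pre_digraph \<Rightarrow> (('v, 'e) path \<Rightarrow>\<^sub>0 'k::field) \<Rightarrow> (('v, 'e) path \<Rightarrow>\<^sub>0 'k)
      \<Rightarrow> (('v, 'e) path \<Rightarrow>\<^sub>0 'k)" where
  "path_times G f g =
     (\<Sum>p\<in>Poly_Mapping.keys f. \<Sum>q\<in>Poly_Mapping.keys g.
        if path_end G p = fst q
        then Poly_Mapping.single (fst p, snd p @ snd q)
               (Poly_Mapping.lookup f p * Poly_Mapping.lookup g q)
        else 0)"

definition path_algebra ::
    "'k::field itself \<Rightarrow> ('v, 'e) pre_digraph \<Rightarrow> (('v, 'e) path \<Rightarrow>\<^sub>0 'k) ring" where
  "path_algebra _ G = \<lparr>
     carrier = {f. Poly_Mapping.keys f \<subseteq> paths G},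
     mult = path_times G,
     one = (\<Sum>v\<in>verts G. Poly_Mapping.single (v, []) 1),
     zero = 0,
     add = (+)\<rparr>"

abbreviation path_elt :: "'v \<Rightarrow> 'e list \<Rightarrow> (('v, 'e) path \<Rightarrow>\<^sub>0 'k::field)" where
  "path_elt v p \<equiv> Poly_Mapping.single (v, p) 1"


section \<open>Brauer configuration algebras\<close>

abbreviation cycle_power :: "'e list \<Rightarrow> nat \<Rightarrow> 'e list" where
  "cycle_power C n \<equiv> concat (replicate n C)"

definition relations_one ::
    "('a, 'l) brauer_config \<Rightarrow> (('l, 'a \<times> nat) path \<Rightarrow>\<^sub>0 'k::field) set" where
  "relations_one \<Gamma> =
     {path_elt V (cycle_power C (mu \<Gamma> \<alpha>)) - path_elt V (cycle_power D (mu \<Gamma> \<beta>)) | V \<alpha> \<beta> C D.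
        V \<in> polygons \<Gamma> \<and>
        \<alpha> \<in> nontruncated \<Gamma> \<and> \<alpha> \<in># polygon \<Gamma> V \<and> C \<in> special_cycles_at \<Gamma> \<alpha> V \<and>
        \<beta> \<in> nontruncated \<Gamma> \<and> \<beta> \<in># polygon \<Gamma> V \<and> D \<in> special_cycles_at \<Gamma> \<beta> V}"

definition relations_two ::
    "('a, 'l) brauer_config \<Rightarrow> (('l, 'a \<times> nat) path \<Rightarrow>\<^sub>0 'k::field) set" where
  "relations_two \<Gamma> =
     {path_elt (tail (quiver \<Gamma>) (hd C)) (cycle_power C (mu \<Gamma> \<alpha>) @ [hd C]) | \<alpha> C.
        \<alpha> \<in> nontruncated \<Gamma> \<and> C \<in> special_cycles \<Gamma> \<alpha>}"

definition relations_three ::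
    "('a, 'l) brauer_config \<Rightarrow> (('l, 'a \<times> nat) path \<Rightarrow>\<^sub>0 'k::field) set" where
  "relations_three \<Gamma> =
     {path_elt (tail (quiver \<Gamma>) a) [a, b] | a b.
        a \<in> arcs (quiver \<Gamma>) \<and> b \<in> arcs (quiver \<Gamma>) \<and> head (quiver \<Gamma>) a = tail (quiver \<Gamma>) b \<and>
        \<not> (\<exists>\<alpha>\<in>nontruncated \<Gamma>. \<exists>C\<in>special_cycles \<Gamma> \<alpha>. sublist [a, b] C) \<and>
        \<not> (\<exists>\<alpha>\<in>vertices \<Gamma>. valence \<Gamma> \<alpha> = 1 \<and> mu \<Gamma> \<alpha> > 1 \<and> a = (\<alpha>, 0) \<and> b = (\<alpha>, 0))}"

definition brauer_path_algebra ::
    "'k::field itself \<Rightarrow> ('a, 'l) brauer_config \<Rightarrow> (('l, 'a \<times> nat) path \<Rightarrow>\<^sub>0 'k) ring" where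
  "brauer_path_algebra K \<Gamma> = path_algebra K (quiver \<Gamma>)"

definition brauer_ideal ::
    "'k::field itself \<Rightarrow> ('a, 'l) brauer_config \<Rightarrow> (('l, 'a \<times> nat) path \<Rightarrow>\<^sub>0 'k) set" where
  "brauer_ideal K \<Gamma> =
     genideal (brauer_path_algebra K \<Gamma>) (relations_one \<Gamma> \<union> relations_two \<Gamma> \<union> relations_three \<Gamma>)"

definition brauer_algebra ::
    "'k::field itself \<Rightarrow> ('a, 'l) brauer_config \<Rightarrow> (('l, 'a \<times> nat) path \<Rightarrow>\<^sub>0 'k) set ring" where
  "brauer_algebra K \<Gamma> = brauer_path_algebra K \<Gamma> Quot brauer_ideal K \<Gamma>"

definition vertex_idem ::
    "'k::field itself \<Rightarrow> ('a, 'l) brauer_config \<Rightarrow> 'l \<Rightarrow> (('l, 'a \<times> nat) path \<Rightarrow>\<^sub>0 'k) set" where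
  "vertex_idem K \<Gamma> V = brauer_ideal K \<Gamma> +>\<^bsub>brauer_path_algebra K \<Gamma>\<^esub> path_elt V []"


section \<open>Right modules and length\<close>

text \<open>
  Right modules over a ring reuse the record \<^typ>\<open>('a, 'b) module\<close> of the library (whose
  locale \<^locale>\<open>module\<close> is restricted to commutative rings): \<open>smult M a x\<close> stands for the
  right action \<open>x \<cdot> a\<close>.  The fields \<open>mult\<close> and \<open>one\<close> of \<open>M\<close> play no role.
\<close>

definition right_submodule :: "('a, 'r) ring_scheme \<Rightarrow> ('a, 'b, 'm) module_scheme \<Rightarrow> 'b set \<Rightarrow> bool" where
  "right_submodule R M N \<longleftrightarrow>
     additive_subgroup N M \<and> (\<forall>a\<in>carrier R. \<forall>x\<in>N. smult M a x \<in> N)"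

text \<open>
  A chain of submodules from \<open>0\<close> to \<open>M\<close> all of whose factors are simple, i.e. without a
  submodule strictly between neighbouring terms.
\<close>

definition composition_series ::
    "('a, 'r) ring_scheme \<Rightarrow> ('a, 'b, 'm) module_scheme \<Rightarrow> 'b set list \<Rightarrow> bool" where
  "composition_series R M Ns \<longleftrightarrow>
     Ns \<noteq> [] \<and> hd Ns = {\<zero>\<^bsub>M\<^esub>} \<and> last Ns = carrier M \<and>
     (\<forall>N\<in>set Ns. right_submodule R M N) \<and>
     (\<forall>i. Suc i < length Ns \<longrightarrow>
        Ns ! i \<subset> Ns ! Suc i \<and>
        \<not> (\<exists>N. right_submodule R M N \<and> Ns ! i \<subset> N \<and> N \<subset> Ns ! Suc i))"

definition right_module_length ::
    "('a, 'r) ring_scheme \<Rightarrow> ('a, 'b, 'm) module_scheme \<Rightarrow> enat" where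
  "right_module_length R M =
     (if \<exists>Ns. composition_series R M Ns
      then enat (length (SOME Ns. composition_series R M Ns) - 1)
      else \<infinity>)"

definition principal_right_module :: "('a, 'r) ring_scheme \<Rightarrow> 'a \<Rightarrow> ('a, 'a) module" where
  "principal_right_module R e = \<lparr>
     carrier = {e \<otimes>\<^bsub>R\<^esub> x | x. x \<in> carrier R},
     mult = mult R,
     one = e,
     zero = \<zero>\<^bsub>R\<^esub>,
     add = add R,
     smult = (\<lambda>a x. x \<otimes>\<^bsub>R\<^esub> a)\<rparr>"

end

theory Submission
  imports Defs
begin

text \<open>
  Every nonzero path of the algebra runs along a single special cycle, and the paths that
  traverse a special cycle completely (to the power of its multiplicity) are identified at each
  polygon.  Sending a path to its normal form, or to \<open>0\<close>, extends to a linear projection \<open>\<pi>\<close> of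
  the path algebra with \<open>\<pi> (f g) = \<pi> (\<pi> f \<cdot> g) = \<pi> (f \<cdot> \<pi> g)\<close>; hence its kernel is an ideal, and
  it is the defining ideal.  So the normal forms starting at \<open>V\<close> are a basis of \<open>v\<Lambda>\<close>.  Multiplying
  a basis path by a nontrivial path lengthens it, turns it into the full cycle or kills it, so
  adjoining the basis elements one at a time, the full cycle first and then in order of decreasing
  length, gives a composition series, and the length is the number of basis elements.
\<close>

section \<open>Composition series\<close>

text \<open>The defining ideal is known only through generators, so exhibiting elements of it is
  easy, while showing that the basis paths stay independent modulo it is the obstacle. An explicit
  two-sided ideal that contains the generators and meets the span of the basis only in 0 removes it.
  In the count, the 2 stands for the trivial path and for the common class of all full cycles at V.
  Each position of V in the successor sequence at a nontruncated \<alpha> starts one path of every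
  length from 1 to val(\<alpha>)mu(\<alpha>) - 1, and there are occ(\<alpha>,V) such positions. A
  truncated vertex has val(\<alpha>)mu(\<alpha>) - 1 = 0, so the sum may run over all vertices of V.
  The length is read off an arbitrarily chosen composition series, so the number of terms must be
  shown not to depend on the choice. Only the ring acts on the module; scaling a basis path by a
  field element is done by multiplying it with a multiple of a trivial path.\<close>

locale right_module = abelian_group M for R :: "('a, 'r) ring_scheme"
  and M :: "('a, 'b, 'm) module_scheme" (structure) +
  assumes smult_add: "\<lbrakk>a \<in> carrier R; x \<in> carrier M; y \<in> carrier M\<rbrakk> \<Longrightarrow>
    smult M a (x \<oplus> y) = smult M a x \<oplus> smult M a y"
begin

lemma right_submodule_subset: "right_submodule R M N \<Longrightarrow> N \<subseteq> carrier M"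
  unfolding right_submodule_def by (meson additive_subgroup.a_subset)

lemma right_submodule_minus:
  assumes "right_submodule R M N" "x \<in> N" "y \<in> N"
  shows "x \<ominus> y \<in> N"
  using assms unfolding right_submodule_def a_minus_def
  by (meson abelian_group_axioms additive_subgroup.a_closed additive_subgroup.a_inv_closed)

lemma right_submodule_Int:
  assumes "right_submodule R M N" "right_submodule R M N'"
  shows "right_submodule R M (N \<inter> N')"
proof -
  have "subgroup (N \<inter> N') (add_monoid M)"
    using assms add.subgroups_Inter_pair
    unfolding right_submodule_def additive_subgroup_def by blast
  then show ?thesis
    using assms unfolding right_submodule_def additive_subgroup_def by blast
qed

lemma right_submodule_add:
  assumes "right_submodule R M N" "right_submodule R M N'"
  shows "right_submodule R M (N <+>\<^bsub>M\<^esub> N')"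
proof -
  have "smult M a z \<in> N <+>\<^bsub>M\<^esub> N'" if a: "a \<in> carrier R" and z: "z \<in> N <+>\<^bsub>M\<^esub> N'" for a z
  proof -
    obtain x y where xy: "x \<in> N" "y \<in> N'" "z = x \<oplus> y"
      using z unfolding set_add_def' by blast
    have "smult M a z = smult M a x \<oplus> smult M a y"
      using smult_add[OF a] xy assms right_submodule_subset by blast
    moreover have "smult M a x \<in> N" "smult M a y \<in> N'"
      using a xy assms unfolding right_submodule_def by blast+
    ultimately show ?thesis
      unfolding set_add_def' by blast
  qed
  then show ?thesis
    using assms add_additive_subgroups unfolding right_submodule_def by blast
qed

text \<open>A modular law argument, with M_i the i-th term of \<open>Ms\<close>: by induction the
  part of N' in M_i lies in N. Where N' meets a factor, so does N, and simplicity of the factor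
  forces M_i + (N \<inter> M_(i+1)) to be all of M_(i+1). Since N is contained in N', the
  M_i-component of an element of N' is again in N', and the induction hypothesis puts it into
  N.\<close>

lemma right_submodule_eqI:
  assumes Ms: "composition_series R M Ms"
    and N: "right_submodule R M N" and N': "right_submodule R M N'" and sub: "N \<subseteq> N'"
    and jumps: "\<And>i. Suc i < length Ms \<Longrightarrow> N' \<inter> Ms ! Suc i - Ms ! i \<noteq> {}
      \<Longrightarrow> N \<inter> Ms ! Suc i - Ms ! i \<noteq> {}"
  shows "N = N'"
proof -
  have subm: "right_submodule R M (Ms ! i)" if "i < length Ms" for i
    using Ms that unfolding composition_series_def by simp
  have step: "N' \<inter> Ms ! i \<subseteq> N" if "i < length Ms" for i
    using that
  proof (induction i)
    case 0
    have "Ms ! 0 = {\<zero>}"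
      using Ms unfolding composition_series_def by (metis hd_conv_nth)
    then show ?case
      using N unfolding right_submodule_def
      by (metis Int_lower2 additive_subgroup.zero_closed insert_subset empty_subsetI subset_trans)
  next
    case (Suc i)
    have i: "i < length Ms" using Suc.prems by simp
    show ?case
    proof (cases "N' \<inter> Ms ! Suc i - Ms ! i = {}")
      case True
      then show ?thesis using Suc.IH[OF i] by blast
    next
      case False
      then obtain w where w: "w \<in> N" "w \<in> Ms ! Suc i" "w \<notin> Ms ! i"
        using jumps[OF Suc.prems] by blast
      let ?S = "Ms ! i <+>\<^bsub>M\<^esub> (N \<inter> Ms ! Suc i)"
      have sub_i: "Ms ! i \<subset> Ms ! Suc i"
        using Ms Suc.prems unfolding composition_series_def by blast
      have S: "right_submodule R M ?S"
        by (intro right_submodule_add right_submodule_Int subm i N Suc.prems)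
      have carr: "Ms ! Suc i \<subseteq> carrier M" using right_submodule_subset[OF subm[OF Suc.prems]] .
      have z_in: "\<zero> \<in> N" "\<zero> \<in> Ms ! j" if "j < length Ms" for j
        using N subm[OF that] unfolding right_submodule_def
          by (meson additive_subgroup.zero_closed)+
      have "Ms ! i \<subseteq> ?S"
      proof
        fix x assume x: "x \<in> Ms ! i"
        then have "x = x \<oplus> \<zero>" using carr sub_i by auto
        then show "x \<in> ?S"
          using x z_in[OF Suc.prems] unfolding set_add_def' by blast
      qed
      moreover have "w \<in> ?S"
      proof -
        have "w = \<zero> \<oplus> w" using w carr by auto
        then show ?thesis using w z_in[OF i] unfolding set_add_def' by blast
      qed
      ultimately have "Ms ! i \<subset> ?S" using w by blast
      moreover have "?S \<subseteq> Ms ! Suc i"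
        using sub_i subm[OF Suc.prems] unfolding set_add_def' right_submodule_def
        by (auto intro!: additive_subgroup.a_closed)
      ultimately have eq: "?S = Ms ! Suc i"
        using Ms Suc.prems S unfolding composition_series_def by (metis psubsetI)
      show ?thesis
      proof
        fix x assume x: "x \<in> N' \<inter> Ms ! Suc i"
        then obtain y n where yn: "y \<in> Ms ! i" "n \<in> N" "n \<in> Ms ! Suc i" "x = y \<oplus> n"
          using eq unfolding set_add_def' by blast
        have c: "y \<in> carrier M" "n \<in> carrier M" using yn carr sub_i by auto
        have "y = x \<ominus> n" using yn(4) c by (simp add: a_minus_def a_assoc r_neg)
        moreover have "x \<ominus> n \<in> N'"
          using right_submodule_minus[OF N'] x yn(2) sub by blast
        ultimately have "y \<in> N" using Suc.IH[OF i] yn(1) by blast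
        then show "x \<in> N"
          using yn N unfolding right_submodule_def by (auto intro: additive_subgroup.a_closed)
      qed
    qed
  qed
  have "Ms ! (length Ms - 1) = carrier M"
    using Ms unfolding composition_series_def by (metis last_conv_nth)
  moreover have "Ms \<noteq> []" using Ms unfolding composition_series_def by simp
  ultimately have "N' \<subseteq> N"
    using step[of "length Ms - 1"] right_submodule_subset[OF N'] by auto
  with sub show ?thesis by blast
qed

text \<open>
  The factors of the composition series that a submodule meets nontrivially determine it among
  its submodules, so their number strictly grows along a strict chain.
\<close>

lemma strict_chain_length_le:
  assumes Ms: "composition_series R M Ms"
    and Ns: "\<forall>N\<in>set Ns. right_submodule R M N"
    and strict: "\<And>i. Suc i < length Ns \<Longrightarrow> Ns ! i \<subset> Ns ! Suc i"
  shows "length Ns \<le> length Ms"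
proof -
  define jumps where "jumps N = {i. Suc i < length Ms \<and> N \<inter> Ms ! Suc i - Ms ! i \<noteq> {}}" for N
  have jumps_sub: "jumps N \<subseteq> {..<length Ms - 1}" for N
    unfolding jumps_def by auto
  have grow: "k \<le> card (jumps (Ns ! k))" if "k < length Ns" for k
    using that
  proof (induction k)
    case (Suc k)
    have "jumps (Ns ! k) \<subseteq> jumps (Ns ! Suc k)"
      using strict[OF Suc.prems] unfolding jumps_def by blast
    moreover have "jumps (Ns ! k) \<noteq> jumps (Ns ! Suc k)"
    proof
      assume eq: "jumps (Ns ! k) = jumps (Ns ! Suc k)"
      have "Ns ! k = Ns ! Suc k"
      proof (rule right_submodule_eqI[OF Ms])
        show "right_submodule R M (Ns ! k)" "right_submodule R M (Ns ! Suc k)"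
          using Ns Suc.prems by simp_all
        show "Ns ! k \<subseteq> Ns ! Suc k" using strict[OF Suc.prems] by blast
        show "Ns ! k \<inter> Ms ! Suc i - Ms ! i \<noteq> {}"
          if "Suc i < length Ms" "Ns ! Suc k \<inter> Ms ! Suc i - Ms ! i \<noteq> {}" for i
          using eq that unfolding jumps_def by blast
      qed
      then show False using strict[OF Suc.prems] by blast
    qed
    ultimately have "card (jumps (Ns ! k)) < card (jumps (Ns ! Suc k))"
      by (meson finite_lessThan finite_subset jumps_sub psubsetI psubset_card_mono)
    then show ?case using Suc by simp
  qed simp
  have "Ms \<noteq> []" using Ms unfolding composition_series_def by simp
  then show ?thesis
    using grow[of "length Ns - 1"] card_mono[OF _ jumps_sub[of "Ns ! (length Ns - 1)"]]
    by (cases Ns; cases Ms) auto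
qed

text \<open>Comparing two composition series in both directions by
  \<open>strict_chain_length_le\<close> gives equal lengths, so the series picked by
  \<open>SOME\<close> is as good as any other.\<close>

lemma right_module_length_eq:
  assumes Ms: "composition_series R M Ms"
  shows "right_module_length R M = enat (length Ms - 1)"
proof -
  have le: "length Ns \<le> length Ms'"
    if "composition_series R M Ns" "composition_series R M Ms'" for Ns Ms'
    using strict_chain_length_le[OF that(2), of Ns] that(1) unfolding composition_series_def
      by blast
  have "composition_series R M (SOME Ns. composition_series R M Ns)"
    using Ms by (rule someI)
  then have "length (SOME Ns. composition_series R M Ns) = length Ms"
    using Ms le by (simp add: le_antisym)
  then show ?thesis
    using Ms unfolding right_module_length_def by auto
qed

end


section \<open>Path algebras\<close>

lemma poly_mapping_sum_singles:
  "(f :: 'x \<Rightarrow>\<^sub>0 'c::comm_monoid_add) = (\<Sum>p\<in>Poly_Mapping.keys f. Poly_Mapping.single p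
    (Poly_Mapping.lookup f p))"
  by (rule poly_mapping_eqI)
    (simp add: lookup_sum lookup_single "when_def" in_keys_iff sum.delta cong: if_cong)

text \<open>Reduces additive statements to single basis elements. The set P serves those that are
  established only for combinations of genuine paths.\<close>

lemma poly_mapping_keys_induct [consumes 1, case_names zero single add]:
  fixes f :: "'x \<Rightarrow>\<^sub>0 'c::comm_monoid_add"
  assumes keys: "Poly_Mapping.keys f \<subseteq> P"
    and zero: "Q 0"
    and single: "\<And>p c. p \<in> P \<Longrightarrow> Q (Poly_Mapping.single p c)"
    and add: "\<And>f g. Q f \<Longrightarrow> Q g \<Longrightarrow> Q (f + g)"
  shows "Q f"
proof -
  have "Q (\<Sum>p\<in>S. Poly_Mapping.single p (Poly_Mapping.lookup f p))" if "finite S" "S \<subseteq> P" for S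
    using that by (induction S) (auto intro: zero single add)
  then show ?thesis
    using keys by (subst poly_mapping_sum_singles) simp
qed

lemmas poly_mapping_single_induct [case_names zero single add] =
  poly_mapping_keys_induct[OF subset_UNIV]

text \<open>With \<open>None\<close> as zero, composing linear extensions becomes
  \<open>Option.bind\<close> on basis elements, so identities between them turn into identities
  between partial maps.\<close>

definition opt_single :: "'x option \<Rightarrow> 'c::zero \<Rightarrow> 'x \<Rightarrow>\<^sub>0 'c" where
  "opt_single o' c = (case o' of None \<Rightarrow> 0 | Some x \<Rightarrow> Poly_Mapping.single x c)"

lemma opt_single_simps [simp]:
  "opt_single None c = 0" "opt_single (Some x) c = Poly_Mapping.single x c" "opt_single o' 0 = 0"
  by (auto simp: opt_single_def split: option.split)

lemma opt_single_add: "opt_single o' (a + b) = opt_single o' a + opt_single o' b"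
  by (cases o') (auto simp: single_add)

text \<open>Maps between bases are extended linearly, \<open>None\<close> standing for the value \<open>0\<close>.\<close>

definition lin :: "('x \<Rightarrow> 'y option) \<Rightarrow> ('x \<Rightarrow>\<^sub>0 'c::comm_monoid_add) \<Rightarrow> ('y \<Rightarrow>\<^sub>0 'c)" where
  "lin F f = (\<Sum>x\<in>Poly_Mapping.keys f. opt_single (F x) (Poly_Mapping.lookup f x))"

lemma lin_zero [simp]: "lin F 0 = 0"
  by (simp add: lin_def)

lemma lin_add: "lin F (f + g) = lin F f + lin F g"
  unfolding lin_def by (rule setsum_keys_plus_distrib) (simp_all add: opt_single_add)

lemma lin_single [simp]: "lin F (Poly_Mapping.single x c) = opt_single (F x) c"
  by (simp add: lin_def)

lemma lin_opt_single [simp]: "lin F (opt_single o' c) = opt_single (Option.bind o' F) c"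
  by (cases o') simp_all

lemma lin_diff: "lin F (f - g) = lin F f - lin F (g :: _ \<Rightarrow>\<^sub>0 'c::ab_group_add)"
  using lin_add[of F "f - g" g] by simp

lemma keys_lin_subset:
  assumes "\<And>x y. x \<in> Poly_Mapping.keys f \<Longrightarrow> F x = Some y \<Longrightarrow> y \<in> S"
  shows "Poly_Mapping.keys (lin F f) \<subseteq> S"
proof -
  have "Poly_Mapping.keys (opt_single (F x) c) \<subseteq> S" if "x \<in> Poly_Mapping.keys f" for x c
    using assms[OF that] by (cases "F x") auto
  then show ?thesis
    unfolding lin_def by (intro order_trans[OF keys_sum] UN_least)
qed

lemma lin_id:
  assumes "\<And>x. x \<in> Poly_Mapping.keys f \<Longrightarrow> F x = Some x"
  shows "lin F f = f"
proof -
  have "lin F f = (\<Sum>p\<in>Poly_Mapping.keys f. Poly_Mapping.single p (Poly_Mapping.lookup f p))"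
    unfolding lin_def using assms by (intro sum.cong) simp_all
  then show ?thesis using poly_mapping_sum_singles[of f] by simp
qed

section \<open>Multiplication of paths\<close>

definition path_comp :: "('v, 'e) pre_digraph \<Rightarrow> ('v, 'e) path \<Rightarrow> ('v, 'e) path \<Rightarrow> ('v, 'e) path
  option" where
  "path_comp G p q = (if path_end G p = fst q then Some (fst p, snd p @ snd q) else None)"

lemma path_end_eq: "path_end G p = (if snd p = [] then fst p else head G (last (snd p)))"
  by (simp add: path_end_def pre_digraph.awalk_verts_conv)

text \<open>The end of a pair depends only on its last arrow, or on its start if there is none.
  Hence this holds for arbitrary pairs, and \<open>path_times_assoc\<close> needs no restriction to
  the carrier.\<close>

lemma path_comp_assoc:
  "Option.bind (path_comp G p q) (\<lambda>s. path_comp G s r)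
    = Option.bind (path_comp G q r) (path_comp G p)"
  by (auto simp: path_comp_def path_end_eq bind_eq_Some_conv)

lemma path_times_eq:
  "path_times G f g = (\<Sum>p\<in>Poly_Mapping.keys f. \<Sum>q\<in>Poly_Mapping.keys g.
     opt_single (path_comp G p q) (Poly_Mapping.lookup f p * Poly_Mapping.lookup g q))"
  unfolding path_times_def by (intro sum.cong refl) (simp add: path_comp_def)

lemma path_times_add_left: "path_times G (f + f') g = path_times G f g + path_times G f' g"
  unfolding path_times_eq
  by (rule setsum_keys_plus_distrib) (simp_all add: distrib_right opt_single_add sum.distrib)

lemma path_times_add_right: "path_times G f (g + g') = path_times G f g + path_times G f g'"
  unfolding path_times_eq sum.swap[of _ _ "Poly_Mapping.keys f"]
  by (rule setsum_keys_plus_distrib) (simp_all add: distrib_left opt_single_add sum.distrib)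

lemma path_times_zero [simp]: "path_times G 0 g = 0" "path_times G f 0 = 0"
  by (simp_all add: path_times_eq)

lemma path_times_single [simp]:
  "path_times G (Poly_Mapping.single p a) (Poly_Mapping.single q b)
    = opt_single (path_comp G p q) (a * b)"
  by (auto simp: path_times_eq)

lemma path_times_opt_single:
  "path_times G (opt_single o' a) (Poly_Mapping.single q b)
    = opt_single (Option.bind o' (\<lambda>p. path_comp G p q)) (a * b)"
  "path_times G (Poly_Mapping.single p a) (opt_single o' b)
    = opt_single (Option.bind o' (path_comp G p)) (a * b)"
  by (cases o'; simp)+

lemma path_times_assoc: "path_times G (path_times G f g) h = path_times G f (path_times G g h)"
proof (induction f rule: poly_mapping_single_induct)
  case (single p a)
  show ?case
  proof (induction g rule: poly_mapping_single_induct)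
    case (single q b)
    show ?case
      by (induction h rule: poly_mapping_single_induct)
        (simp_all add: path_times_add_right path_times_opt_single path_comp_assoc mult.assoc)
  qed (simp_all add: path_times_add_left path_times_add_right)
qed (simp_all add: path_times_add_left)

lemma path_times_sum_left: "path_times G (\<Sum>i\<in>S. f i) g = (\<Sum>i\<in>S. path_times G (f i) g)"
  by (induction S rule: infinite_finite_induct) (simp_all add: path_times_add_left)

lemma path_times_sum_right: "path_times G g (\<Sum>i\<in>S. f i) = (\<Sum>i\<in>S. path_times G g (f i))"
  by (induction S rule: infinite_finite_induct) (simp_all add: path_times_add_right)

context wf_digraph
begin

lemma mem_paths_iff: "(u, p) \<in> paths G \<longleftrightarrow> awalk u p (path_end G (u, p))"
  by (auto simp: paths_def path_end_def)

lemma path_comp_in_paths: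
  assumes "p \<in> paths G" "q \<in> paths G" "path_comp G p q = Some r"
  shows "r \<in> paths G"
proof -
  obtain u as w bs where pq: "p = (u, as)" "q = (w, bs)" by (meson surj_pair)
  have r: "r = (u, as @ bs)" "path_end G p = w"
    using assms(3) unfolding path_comp_def pq by (auto split: if_splits)
  have "awalk u as w" "awalk w bs (path_end G q)"
    using assms(1,2) r(2) pq by (simp_all add: mem_paths_iff)
  then have "awalk u (as @ bs) (path_end G q)" by (rule awalk_appendI)
  then show ?thesis unfolding r paths_def by blast
qed

lemma path_times_in_paths:
  assumes "Poly_Mapping.keys f \<subseteq> paths G" "Poly_Mapping.keys g \<subseteq> paths G"
  shows "Poly_Mapping.keys (path_times G f g) \<subseteq> paths G"
proof -
  have "Poly_Mapping.keys (opt_single (path_comp G p q) c) \<subseteq> paths G"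
    if "p \<in> Poly_Mapping.keys f" "q \<in> Poly_Mapping.keys g" for p q c
    using path_comp_in_paths[of p q] assms that by (cases "path_comp G p q") auto
  then show ?thesis
    unfolding path_times_eq by (intro order_trans[OF keys_sum] UN_least)
qed

lemma path_end_in_verts: "p \<in> paths G \<Longrightarrow> path_end G p \<in> verts G"
  by (cases p) (auto simp: mem_paths_iff)

lemma fst_path_in_verts: "p \<in> paths G \<Longrightarrow> fst p \<in> verts G"
  by (cases p) (auto simp: mem_paths_iff)

lemma trivial_in_paths: "(v, []) \<in> paths G \<longleftrightarrow> v \<in> verts G"
  by (simp add: mem_paths_iff awalk_Nil_iff path_end_eq)

lemma path_times_one:
  assumes fin: "finite (verts G)" and f: "Poly_Mapping.keys f \<subseteq> paths G"
  shows "path_times G (\<Sum>v\<in>verts G. Poly_Mapping.single (v, []) 1) f = f"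
    and "path_times G f (\<Sum>v\<in>verts G. Poly_Mapping.single (v, []) 1) = f"
proof -
  show "path_times G (\<Sum>v\<in>verts G. Poly_Mapping.single (v, []) 1) f = f"
    using f
  proof (induction f rule: poly_mapping_keys_induct)
    case (single p c)
    have "(\<Sum>v\<in>verts G. opt_single (path_comp G (v, []) p) c) =
        (\<Sum>v\<in>verts G. if v = fst p then Poly_Mapping.single p c else 0)"
      by (intro sum.cong refl) (auto simp: path_comp_def path_end_eq)
    then show ?case
      using fin fst_path_in_verts[OF single] by (simp add: path_times_sum_left)
  qed (simp_all add: path_times_add_right)
  show "path_times G f (\<Sum>v\<in>verts G. Poly_Mapping.single (v, []) 1) = f"
    using f
  proof (induction f rule: poly_mapping_keys_induct)
    case (single p c)
    have "(\<Sum>v\<in>verts G. opt_single (path_comp G p (v, [])) c) =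
        (\<Sum>v\<in>verts G. if v = path_end G p then Poly_Mapping.single p c else 0)"
      by (intro sum.cong refl) (auto simp: path_comp_def)
    then show ?case
      using fin path_end_in_verts[OF single] by (simp add: path_times_sum_right)
  qed (simp_all add: path_times_add_left)
qed

lemma ring_path_algebra:
  assumes fin: "finite (verts G)"
  shows "ring (path_algebra K G)"
proof (rule ringI)
  have keys_add: "Poly_Mapping.keys (f + g) \<subseteq> paths G"
    if "Poly_Mapping.keys f \<subseteq> paths G" "Poly_Mapping.keys g \<subseteq> paths G" for f g
    using that keys_add[of f g] by blast
  show "abelian_group (path_algebra K G)"
  proof (rule abelian_groupI)
    fix f assume "f \<in> carrier (path_algebra K G)"
    then show "\<exists>g\<in>carrier (path_algebra K G). g \<oplus>\<^bsub>path_algebra K G\<^esub> f = \<zero>\<^bsub>path_algebra K G\<^esub>"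
      by (intro bexI[of _ "- f"]) (auto simp: path_algebra_def)
  qed (auto simp: path_algebra_def algebra_simps keys_add)
  show "monoid (path_algebra K G)"
  proof (rule monoidI)
    have "Poly_Mapping.keys (\<Sum>v\<in>verts G. Poly_Mapping.single (v, []) (1::'c)) \<subseteq> paths G"
      by (rule order_trans[OF keys_sum]) (auto simp: trivial_in_paths)
    then show "\<one>\<^bsub>path_algebra K G\<^esub> \<in> carrier (path_algebra K G)"
      by (simp add: path_algebra_def)
  qed (simp_all add: path_algebra_def path_times_in_paths path_times_assoc path_times_one fin)
qed (simp_all add: path_algebra_def path_times_add_left path_times_add_right)

end


section \<open>Normal forms of paths\<close>

text \<open>At valence 1 the arrow follows itself, because \<open>Suc 0 mod 1 = 0\<close>; this
  absorbs the exception for squares of loops in the type three relations (see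
  \<open>cyc_next_iff\<close>).\<close>

definition cyc_next :: "('a, 'l) brauer_config \<Rightarrow> 'a \<times> nat \<Rightarrow> 'a \<times> nat \<Rightarrow> bool" where
  "cyc_next \<Gamma> a b \<longleftrightarrow> fst a = fst b \<and> snd b = Suc (snd a) mod valence \<Gamma> (fst a)"

text \<open>Reduction modulo the valence lets a run wind around the special cycle any number of
  times and start at an unreduced index, so runs split and concatenate without case
  distinctions.\<close>

definition run :: "('a, 'l) brauer_config \<Rightarrow> 'a \<Rightarrow> nat \<Rightarrow> nat \<Rightarrow> ('a \<times> nat) list" where
  "run \<Gamma> \<alpha> j n = map (\<lambda>i. (\<alpha>, (j + i) mod valence \<Gamma> \<alpha>)) [0..<n]"

text \<open>The number of arrows in the power C^mu(\<alpha>) of a special \<alpha>-cycle, with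
  \<alpha> read off the first arrow. It is meaningful for nonempty lists only, whence the
  nonemptiness conditions below.\<close>

definition run_bound :: "('a, 'l) brauer_config \<Rightarrow> ('a \<times> nat) list \<Rightarrow> nat" where
  "run_bound \<Gamma> as = valence \<Gamma> (fst (hd as)) * mu \<Gamma> (fst (hd as))"

text \<open>The two disjuncts match the monomial relations: a step off the cyclic order is of type
  three, and an overlong run contains a relation of type two.\<close>

definition zero_path :: "('a, 'l) brauer_config \<Rightarrow> ('a \<times> nat) list \<Rightarrow> bool" where
  "zero_path \<Gamma> as \<longleftrightarrow> as \<noteq> [] \<and> (\<not> successively (cyc_next \<Gamma>) as \<or> run_bound \<Gamma> as < length as)"

definition full_path :: "('a, 'l) brauer_config \<Rightarrow> ('a \<times> nat) list \<Rightarrow> bool" where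
  "full_path \<Gamma> as \<longleftrightarrow> as \<noteq> [] \<and> successively (cyc_next \<Gamma>) as \<and> length as = run_bound \<Gamma> as"

text \<open>Type one relations identify all full paths at V; this one stands for the class. That
  there is one to choose comes from C3.\<close>

definition full_rep :: "('a, 'l) brauer_config \<Rightarrow> 'l \<Rightarrow> ('a \<times> nat) list" where
  "full_rep \<Gamma> V = (SOME as. (V, as) \<in> paths (quiver \<Gamma>) \<and> full_path \<Gamma> as)"

text \<open>
  Modulo the relations a path is \<open>0\<close>, or equal to the chosen full path at its start, or a basis
  element; \<open>None\<close> encodes \<open>0\<close>.
\<close>

definition normal_form ::
    "('a, 'l) brauer_config \<Rightarrow> ('l, 'a \<times> nat) path \<Rightarrow> ('l, 'a \<times> nat) path option" where
  "normal_form \<Gamma> p =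
     (if zero_path \<Gamma> (snd p) then None
      else if full_path \<Gamma> (snd p) then Some (fst p, full_rep \<Gamma> (fst p))
      else Some p)"

section \<open>Runs, zero paths and full paths as lists of arrows\<close>

lemma length_run [simp]: "length (run \<Gamma> \<alpha> j n) = n"
  by (simp add: run_def)

lemma nth_run: "i < n \<Longrightarrow> run \<Gamma> \<alpha> j n ! i = (\<alpha>, (j + i) mod valence \<Gamma> \<alpha>)"
  by (simp add: run_def)

lemma run_eq_Nil_iff [simp]: "run \<Gamma> \<alpha> j n = [] \<longleftrightarrow> n = 0" "[] = run \<Gamma> \<alpha> j n \<longleftrightarrow> n = 0"
  by (auto simp: run_def)

lemma hd_run: "0 < n \<Longrightarrow> hd (run \<Gamma> \<alpha> j n) = (\<alpha>, j mod valence \<Gamma> \<alpha>)"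
  by (subst hd_conv_nth) (simp_all add: nth_run)

lemma run_add: "run \<Gamma> \<alpha> j (m + n) = run \<Gamma> \<alpha> j m @ run \<Gamma> \<alpha> (j + m) n"
  by (rule nth_equalityI) (auto simp: nth_run nth_append add.assoc)

lemma run_period: "run \<Gamma> \<alpha> (j + valence \<Gamma> \<alpha>) n = run \<Gamma> \<alpha> j n"
proof -
  have "(j + valence \<Gamma> \<alpha> + i) mod valence \<Gamma> \<alpha> = (j + i) mod valence \<Gamma> \<alpha>" for i
    by (metis add.assoc add.commute mod_add_self2)
  then show ?thesis unfolding run_def by simp
qed

lemma cycle_power_run:
  "cycle_power (run \<Gamma> \<alpha> j (valence \<Gamma> \<alpha>)) m = run \<Gamma> \<alpha> j (valence \<Gamma> \<alpha> * m)"
  by (induction m) (simp_all add: run_add run_period)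

lemma run_Suc: "run \<Gamma> \<alpha> j (Suc n) = (\<alpha>, j mod valence \<Gamma> \<alpha>) # run \<Gamma> \<alpha> (Suc j) n"
  using run_add[of \<Gamma> \<alpha> j 1 n] by (simp add: run_def)

lemma successively_run: "successively (cyc_next \<Gamma>) (run \<Gamma> \<alpha> j n)"
  by (auto simp: successively_conv_nth nth_run cyc_next_def mod_Suc_eq)

lemma run_bound_run: "0 < n \<Longrightarrow> run_bound \<Gamma> (run \<Gamma> \<alpha> j n) = valence \<Gamma> \<alpha> * mu \<Gamma> \<alpha>"
  by (simp add: run_bound_def hd_run)

text \<open>An arrow has only one cyclic successor, so the first arrow and the length determine the
  list.\<close>

lemma successively_cyc_next_eq_run:
  assumes "successively (cyc_next \<Gamma>) as" "as \<noteq> []" "hd as = (\<alpha>, j)" "j < valence \<Gamma> \<alpha>"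
  shows "as = run \<Gamma> \<alpha> j (length as)"
proof (rule nth_equalityI)
  show "as ! i = run \<Gamma> \<alpha> j (length as) ! i" if "i < length as" for i
    using that
  proof (induction i)
    case 0
    then show ?case using assms by (simp add: nth_run hd_conv_nth)
  next
    case (Suc i)
    have "cyc_next \<Gamma> (as ! i) (as ! Suc i)"
      using successively_nth[OF assms(1) Suc.prems] .
    then show ?case
      using Suc by (auto simp: nth_run cyc_next_def mod_Suc_eq prod_eq_iff)
  qed
qed simp

lemma special_cycles_eq: "special_cycles \<Gamma> \<alpha> = {run \<Gamma> \<alpha> j (valence \<Gamma> \<alpha>) |j. j < valence \<Gamma> \<alpha>}"
proof -
  have "rotate j (map (Pair \<alpha>) [0..<valence \<Gamma> \<alpha>]) = run \<Gamma> \<alpha> j (valence \<Gamma> \<alpha>)" for j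
    by (rule nth_equalityI) (auto simp: nth_run nth_rotate add.commute)
  then show ?thesis unfolding special_cycles_def by simp
qed

lemma successively_cyc_next_fst:
  "successively (cyc_next \<Gamma>) as \<Longrightarrow> a \<in> set as \<Longrightarrow> fst a = fst (hd as)"
proof (induction as)
  case (Cons b as)
  then show ?case by (cases as) (auto simp: cyc_next_def successively_Cons)
qed simp

lemma run_bound_append1: "as \<noteq> [] \<Longrightarrow> run_bound \<Gamma> (as @ bs) = run_bound \<Gamma> as"
  by (simp add: run_bound_def)

lemma run_bound_append2:
  assumes "successively (cyc_next \<Gamma>) (as @ bs)" "bs \<noteq> []"
  shows "run_bound \<Gamma> (as @ bs) = run_bound \<Gamma> bs"
  using successively_cyc_next_fst[OF assms(1), of "hd bs"] assms(2) by (simp add: run_bound_def)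

text \<open>A break in the cyclic order persists. If there is none, all arrows turn around one
  vertex, so the bound is the same for the parts and the whole while the length can only
  grow.\<close>

lemma zero_path_append:
  assumes "zero_path \<Gamma> as \<or> zero_path \<Gamma> bs"
  shows "zero_path \<Gamma> (as @ bs)"
proof (cases "successively (cyc_next \<Gamma>) (as @ bs)")
  case True
  then have "successively (cyc_next \<Gamma>) as" "successively (cyc_next \<Gamma>) bs"
    by (simp_all add: successively_append_iff)
  then show ?thesis
    using assms run_bound_append1[of as \<Gamma> bs] run_bound_append2[OF True] unfolding zero_path_def
      by auto
qed (use assms in \<open>auto simp: zero_path_def\<close>)

text \<open>A full path has already reached the bound, so one more arrow on either side exceeds it
  or breaks the cyclic order.\<close>

lemma zero_path_append_full:
  assumes "full_path \<Gamma> as \<and> bs \<noteq> [] \<or> full_path \<Gamma> bs \<and> as \<noteq> []"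
  shows "zero_path \<Gamma> (as @ bs)"
proof (cases "successively (cyc_next \<Gamma>) (as @ bs)")
  case True
  then show ?thesis
    using assms run_bound_append1[of as \<Gamma> bs] run_bound_append2[OF True]
    unfolding zero_path_def full_path_def by auto
qed (use assms in \<open>auto simp: zero_path_def\<close>)

lemma full_path_not_zero: "full_path \<Gamma> as \<Longrightarrow> \<not> zero_path \<Gamma> as"
  by (simp add: full_path_def zero_path_def)

section \<open>Paths of the induced quiver and their reduction\<close>

context brauer_configuration
begin

lemma mem_vertices: "V \<in> polygons \<Gamma> \<Longrightarrow> \<alpha> \<in># polygon \<Gamma> V \<Longrightarrow> \<alpha> \<in> vertices \<Gamma>"
  using polygon_vertices by blast

lemma valence_pos: "\<alpha> \<in> vertices \<Gamma> \<Longrightarrow> 0 < valence \<Gamma> \<alpha>"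
  using C1 finite_polygons by (force simp: valence_def occ_def sum_pos2)

lemma length_successors: "\<alpha> \<in> nontruncated \<Gamma> \<Longrightarrow> length (successors \<Gamma> \<alpha>) = valence \<Gamma> \<alpha>"
  using sum_count_set[OF successors_polygons finite_polygons] successors_occ
  by (simp add: valence_def)

lemma successors_nth_mem:
  "\<alpha> \<in> nontruncated \<Gamma> \<Longrightarrow> j < valence \<Gamma> \<alpha> \<Longrightarrow> successors \<Gamma> \<alpha> ! j \<in> polygons \<Gamma>"
  using successors_polygons length_successors by (metis nth_mem subsetD)

lemma nontruncatedD: "\<alpha> \<in> nontruncated \<Gamma> \<Longrightarrow> \<alpha> \<in> vertices \<Gamma>"
  by (simp add: nontruncated_def)

lemma arcs_quiver [simp]: "(\<alpha>, j) \<in> arcs (quiver \<Gamma>) \<longleftrightarrow> \<alpha> \<in> nontruncated \<Gamma> \<and> j < valence \<Gamma> \<alpha>"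
  and verts_quiver [simp]: "verts (quiver \<Gamma>) = polygons \<Gamma>"
  and tail_quiver [simp]: "tail (quiver \<Gamma>) (\<alpha>, j) = successors \<Gamma> \<alpha> ! j"
  and head_quiver [simp]: "head (quiver \<Gamma>) (\<alpha>, j) = successors \<Gamma> \<alpha> ! (Suc j mod valence \<Gamma> \<alpha>)"
  by (simp_all add: quiver_def)

sublocale quiver: wf_digraph "quiver \<Gamma>"
  by unfold_locales (auto simp: successors_nth_mem valence_pos nontruncatedD)

lemma awalk_run:
  "\<alpha> \<in> nontruncated \<Gamma> \<Longrightarrow>
    quiver.awalk (successors \<Gamma> \<alpha> ! (j mod valence \<Gamma> \<alpha>)) (run \<Gamma> \<alpha> j n) (successors \<Gamma> \<alpha> ! ((j + n) mod
      valence \<Gamma> \<alpha>))"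
proof (induction n arbitrary: j)
  case 0
  then show ?case
    by (simp add: run_def quiver.awalk_Nil_iff successors_nth_mem valence_pos nontruncatedD)
next
  case (Suc n)
  then show ?case
    using Suc.IH[of "Suc j"]
    by (simp add: run_Suc quiver.awalk_Cons_iff valence_pos nontruncatedD mod_Suc_eq)
qed

lemma run_in_paths:
  assumes "\<alpha> \<in> nontruncated \<Gamma>" "j < valence \<Gamma> \<alpha>"
  shows "(successors \<Gamma> \<alpha> ! j, run \<Gamma> \<alpha> j n) \<in> paths (quiver \<Gamma>)"
  using awalk_run[OF assms(1), of j n] assms(2) unfolding paths_def by auto

lemma path_end_run:
  assumes "\<alpha> \<in> nontruncated \<Gamma>" "j < valence \<Gamma> \<alpha>"
  shows "path_end (quiver \<Gamma>) (successors \<Gamma> \<alpha> ! j, run \<Gamma> \<alpha> j n)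
    = successors \<Gamma> \<alpha> ! ((j + n) mod valence \<Gamma> \<alpha>)"
  using awalk_run[OF assms(1), of j n] assms(2) unfolding path_end_def by simp

lemma path_runE:
  assumes "(V, as) \<in> paths (quiver \<Gamma>)" "as \<noteq> []" "successively (cyc_next \<Gamma>) as"
  obtains \<alpha> j where "\<alpha> \<in> nontruncated \<Gamma>" "j < valence \<Gamma> \<alpha>" "V = successors \<Gamma> \<alpha> ! j"
    "as = run \<Gamma> \<alpha> j (length as)" "run_bound \<Gamma> as = valence \<Gamma> \<alpha> * mu \<Gamma> \<alpha>"
proof -
  obtain \<alpha> j bs where as: "as = (\<alpha>, j) # bs" using assms(2) by (metis list.exhaust surj_pair)
  have "(\<alpha>, j) \<in> arcs (quiver \<Gamma>)" "V = tail (quiver \<Gamma>) (\<alpha>, j)"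
    using assms(1) unfolding paths_def as by (auto simp: quiver.awalk_Cons_iff)
  moreover have "as = run \<Gamma> \<alpha> j (length as)"
    using successively_cyc_next_eq_run[OF assms(3,2), of \<alpha> j] calculation as by simp
  moreover have "run_bound \<Gamma> as = valence \<Gamma> \<alpha> * mu \<Gamma> \<alpha>"
    by (simp add: run_bound_def as)
  ultimately show ?thesis
    using that[of \<alpha> j] by simp
qed

text \<open>The length is a multiple of the valence, so the run returns to its starting position.
  Hence replacing a full path by \<open>full_rep\<close> preserves both endpoints.\<close>

lemma path_end_full:
  assumes "(V, as) \<in> paths (quiver \<Gamma>)" "full_path \<Gamma> as"
  shows "path_end (quiver \<Gamma>) (V, as) = V"
proof -
  obtain \<alpha> j where run: "\<alpha> \<in> nontruncated \<Gamma>" "j < valence \<Gamma> \<alpha>" "V = successors \<Gamma> \<alpha> ! j"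
    "as = run \<Gamma> \<alpha> j (length as)" "run_bound \<Gamma> as = valence \<Gamma> \<alpha> * mu \<Gamma> \<alpha>"
    using path_runE[OF assms(1)] assms(2) unfolding full_path_def by metis
  have "length as = valence \<Gamma> \<alpha> * mu \<Gamma> \<alpha>"
    using assms(2) run(5) by (simp add: full_path_def)
  then show ?thesis
    using path_end_run[OF run(1,2), of "length as"] run(2,3,4) by simp
qed

text \<open>A product of two positive numbers is 1 only if both are; this turns C3 into the
  existence of a nontruncated vertex in every polygon.\<close>

lemma mem_nontruncated:
  assumes "\<alpha> \<in> vertices \<Gamma>"
  shows "\<alpha> \<in> nontruncated \<Gamma> \<longleftrightarrow> 1 < valence \<Gamma> \<alpha> * mu \<Gamma> \<alpha>"
proof -
  have "0 < valence \<Gamma> \<alpha> * mu \<Gamma> \<alpha>" using valence_pos[OF assms] mu_pos[OF assms] by simp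
  moreover have "\<alpha> \<in> nontruncated \<Gamma> \<longleftrightarrow> valence \<Gamma> \<alpha> * mu \<Gamma> \<alpha> \<noteq> 1"
    using assms by (simp add: nontruncated_def truncated_def)
  ultimately show ?thesis by linarith
qed

lemma successors_eq_imp_mem:
  assumes "\<alpha> \<in> nontruncated \<Gamma>" "j < valence \<Gamma> \<alpha>"
  shows "\<alpha> \<in># polygon \<Gamma> (successors \<Gamma> \<alpha> ! j)"
proof -
  have "successors \<Gamma> \<alpha> ! j \<in> set (successors \<Gamma> \<alpha>)"
    using assms length_successors by simp
  then have "0 < count_list (successors \<Gamma> \<alpha>) (successors \<Gamma> \<alpha> ! j)"
    by (metis count_list_0_iff gr0I)
  then show ?thesis
    using successors_occ[OF assms(1) successors_nth_mem[OF assms]] by (simp add: occ_def)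
qed

lemma full_run:
  assumes "\<alpha> \<in> nontruncated \<Gamma>"
  shows "full_path \<Gamma> (run \<Gamma> \<alpha> j (valence \<Gamma> \<alpha> * mu \<Gamma> \<alpha>))"
  using mem_nontruncated[OF nontruncatedD[OF assms]] assms
  by (simp add: full_path_def successively_run run_bound_run valence_pos mu_pos nontruncatedD)

text \<open>C3 supplies a nontruncated \<alpha> in V. As it occurs in V, the polygon appears at some
  position of the successor sequence, and the run of length val(\<alpha>)mu(\<alpha>) from there is
  full.\<close>

lemma full_rep:
  assumes "V \<in> polygons \<Gamma>"
  shows "(V, full_rep \<Gamma> V) \<in> paths (quiver \<Gamma>)" and "full_path \<Gamma> (full_rep \<Gamma> V)"
proof -
  obtain \<alpha> where \<alpha>: "\<alpha> \<in># polygon \<Gamma> V" "valence \<Gamma> \<alpha> * mu \<Gamma> \<alpha> > 1"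
    using C3[OF assms] by blast
  have nt: "\<alpha> \<in> nontruncated \<Gamma>"
    using mem_nontruncated mem_vertices[OF assms \<alpha>(1)] \<alpha>(2) by blast
  have "V \<in> set (successors \<Gamma> \<alpha>)"
    using successors_occ[OF nt assms] \<alpha>(1) by (metis count_list_0_iff count_eq_zero_iff occ_def)
  then obtain j where "j < valence \<Gamma> \<alpha>" "V = successors \<Gamma> \<alpha> ! j"
    using length_successors[OF nt] by (metis in_set_conv_nth)
  then have "\<exists>as. (V, as) \<in> paths (quiver \<Gamma>) \<and> full_path \<Gamma> as"
    using run_in_paths[OF nt] full_run[OF nt] by blast
  then have "(V, full_rep \<Gamma> V) \<in> paths (quiver \<Gamma>) \<and> full_path \<Gamma> (full_rep \<Gamma> V)"
    unfolding full_rep_def by (rule someI_ex)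
  then show "(V, full_rep \<Gamma> V) \<in> paths (quiver \<Gamma>)" "full_path \<Gamma> (full_rep \<Gamma> V)" by blast+
qed

lemma normal_form_in_paths:
  assumes "p \<in> paths (quiver \<Gamma>)" "normal_form \<Gamma> p = Some q"
  shows "q \<in> paths (quiver \<Gamma>)"
  using assms full_rep(1)[OF quiver.fst_path_in_verts[OF assms(1), simplified]]
  by (auto simp: normal_form_def split: if_splits)

lemma path_end_normal_form:
  assumes "p \<in> paths (quiver \<Gamma>)" "normal_form \<Gamma> p = Some q"
  shows "path_end (quiver \<Gamma>) q = path_end (quiver \<Gamma>) p" and "fst q = fst p"
proof -
  have V: "fst p \<in> polygons \<Gamma>" using quiver.fst_path_in_verts[OF assms(1)] by simp
  show "fst q = fst p" using assms(2) by (auto simp: normal_form_def split: if_splits)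
  show "path_end (quiver \<Gamma>) q = path_end (quiver \<Gamma>) p"
    using assms path_end_full[of "fst p" "snd p"] path_end_full[OF full_rep[OF V]]
    by (auto simp: normal_form_def split: if_splits)
qed

lemma normal_form_idem:
  assumes "p \<in> paths (quiver \<Gamma>)" "normal_form \<Gamma> p = Some q"
  shows "normal_form \<Gamma> q = Some q"
  using assms full_rep(2)[OF quiver.fst_path_in_verts[OF assms(1), simplified]]
  by (auto simp: normal_form_def full_path_not_zero split: if_splits)

text \<open>Normalizing a factor first does not affect the normal form of a product. The only
  delicate case is a full factor: next to a trivial path it simply becomes the representative, and
  next to a nontrivial one both it and its representative give zero.\<close>

lemma normal_form_comp_right:
  assumes "q \<in> paths (quiver \<Gamma>)"
  shows "Option.bind (path_comp (quiver \<Gamma>) p q) (normal_form \<Gamma>) =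
    Option.bind (normal_form \<Gamma> q) (\<lambda>r. Option.bind (path_comp (quiver \<Gamma>) p r) (normal_form \<Gamma>))"
proof -
  have V: "fst q \<in> polygons \<Gamma>" using quiver.fst_path_in_verts[OF assms] by simp
  note rep = full_rep[OF V]
  consider "zero_path \<Gamma> (snd q)" | "full_path \<Gamma> (snd q)" "snd p
    = []" | "full_path \<Gamma> (snd q)" "snd p \<noteq> []"
    | "\<not> zero_path \<Gamma> (snd q)" "\<not> full_path \<Gamma> (snd q)" by blast
  then show ?thesis
  proof cases
    case 1
    then show ?thesis
      using zero_path_append[of \<Gamma> "snd p" "snd q"] by (auto simp: normal_form_def path_comp_def)
  next
    case 2
    then show ?thesis
      using rep by (auto simp: normal_form_def path_comp_def path_end_eq full_path_not_zero)
  next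
    case 3
    then show ?thesis
      using rep zero_path_append_full[of \<Gamma> "snd p" "snd q"] zero_path_append_full[of \<Gamma> "snd p"
        "full_rep \<Gamma> (fst q)"]
      by (auto simp: normal_form_def path_comp_def full_path_not_zero)
  next
    case 4
    then show ?thesis by (simp add: normal_form_def)
  qed
qed

lemma normal_form_comp_left:
  assumes "p \<in> paths (quiver \<Gamma>)"
  shows "Option.bind (path_comp (quiver \<Gamma>) p q) (normal_form \<Gamma>) =
    Option.bind (normal_form \<Gamma> p) (\<lambda>r. Option.bind (path_comp (quiver \<Gamma>) r q) (normal_form \<Gamma>))"
proof -
  have V: "fst p \<in> polygons \<Gamma>" using quiver.fst_path_in_verts[OF assms] by simp
  note rep = full_rep[OF V]
  \<comment> \<open>Composability on the right depends on where the left factor ends, so here the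
    representative must end where p does; for a right factor the common start was enough.\<close>
  have ends: "path_end (quiver \<Gamma>) (fst p, full_rep \<Gamma> (fst p)) = path_end (quiver \<Gamma>) p"
    if "full_path \<Gamma> (snd p)"
    using path_end_full[OF rep] path_end_full[of "fst p" "snd p"] assms that by simp
  consider "zero_path \<Gamma> (snd p)" | "full_path \<Gamma> (snd p)" "snd q
    = []" | "full_path \<Gamma> (snd p)" "snd q \<noteq> []"
    | "\<not> zero_path \<Gamma> (snd p)" "\<not> full_path \<Gamma> (snd p)" by blast
  then show ?thesis
  proof cases
    case 1
    then show ?thesis
      using zero_path_append[of \<Gamma> "snd p" "snd q"] by (auto simp: normal_form_def path_comp_def)
  next
    case 2
    then show ?thesis
      using rep ends by (auto simp: normal_form_def path_comp_def full_path_not_zero)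
  next
    case 3
    then show ?thesis
      using rep ends zero_path_append_full[of \<Gamma> "snd p" "snd q"] zero_path_append_full[of \<Gamma>
        "full_rep \<Gamma> (fst p)" "snd q"]
      by (auto simp: normal_form_def path_comp_def full_path_not_zero)
  next
    case 4
    then show ?thesis by (simp add: normal_form_def)
  qed
qed

end


section \<open>The defining ideal\<close>

lemma path_times_diff_right: "path_times G f (g - g') = path_times G f g - path_times G f g'"
  using path_times_add_right[of G f "g - g'" g'] by simp

lemma not_successivelyE:
  assumes "\<not> successively R as"
  obtains xs a b ys where "as = xs @ a # b # ys" "\<not> R a b"
proof -
  obtain i where i: "Suc i < length as" "\<not> R (as ! i) (as ! Suc i)"
    using assms by (auto simp: successively_conv_nth)
  then have "as = take i as @ as ! i # as ! Suc i # drop (Suc (Suc i)) as"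
    by (metis Cons_nth_drop_Suc Suc_lessD append_take_drop_id)
  then show ?thesis using that i(2) by blast
qed

context brauer_configuration
begin

abbreviation "reduce \<equiv> lin (normal_form \<Gamma>)"

lemma reduce_path_times_left:
  assumes "Poly_Mapping.keys f \<subseteq> paths (quiver \<Gamma>)"
  shows "reduce (path_times (quiver \<Gamma>) (reduce f) g) = reduce (path_times (quiver \<Gamma>) f g)"
  using assms
proof (induction f rule: poly_mapping_keys_induct)
  case (single p c)
  show ?case
    by (induction g rule: poly_mapping_single_induct)
      (simp_all add: path_times_add_right lin_add path_times_opt_single normal_form_comp_left[OF
        single])
qed (simp_all add: path_times_add_left lin_add)

lemma reduce_path_times_right:
  assumes "Poly_Mapping.keys g \<subseteq> paths (quiver \<Gamma>)"
  shows "reduce (path_times (quiver \<Gamma>) f (reduce g)) = reduce (path_times (quiver \<Gamma>) f g)"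
  using assms
proof (induction g rule: poly_mapping_keys_induct)
  case (single q c)
  show ?case
    by (induction f rule: poly_mapping_single_induct)
      (simp_all add: path_times_add_left lin_add path_times_opt_single normal_form_comp_right[OF
        single])
qed (simp_all add: path_times_add_right lin_add)

lemma keys_reduce:
  "Poly_Mapping.keys f \<subseteq> paths (quiver \<Gamma>) \<Longrightarrow> Poly_Mapping.keys (reduce f) \<subseteq> paths (quiver \<Gamma>)"
  by (rule keys_lin_subset) (use normal_form_in_paths in blast)

lemma ring_brauer_path_algebra: "ring (brauer_path_algebra K \<Gamma>)"
  unfolding brauer_path_algebra_def using quiver.ring_path_algebra finite_polygons by simp

lemma brauer_path_algebra_simps [simp]:
  "carrier (brauer_path_algebra K \<Gamma>) = {f. Poly_Mapping.keys f \<subseteq> paths (quiver \<Gamma>)}"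
  "mult (brauer_path_algebra K \<Gamma>) = path_times (quiver \<Gamma>)"
  "add (brauer_path_algebra K \<Gamma>) = (+)"
  "zero (brauer_path_algebra K \<Gamma>) = 0"
  by (simp_all add: brauer_path_algebra_def path_algebra_def)

lemma a_inv_brauer_path_algebra:
  assumes "f \<in> carrier (brauer_path_algebra K \<Gamma>)"
  shows "\<ominus>\<^bsub>brauer_path_algebra K \<Gamma>\<^esub> f = - f"
proof -
  interpret A: ring "brauer_path_algebra K \<Gamma>" by (rule ring_brauer_path_algebra)
  show ?thesis
    by (rule A.minus_equality) (use assms in simp_all)
qed

text \<open>Absorption holds because a product with f may be reduced after replacing f by
  \<open>reduce f\<close>, which is 0. This is the ideal that bounds \<open>brauer_ideal\<close>
  from above.\<close>

lemma ideal_reduce_kernel: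
  "ideal {f. Poly_Mapping.keys f \<subseteq> paths (quiver \<Gamma>) \<and> reduce f = 0} (brauer_path_algebra K \<Gamma>)"
    (is "ideal ?N ?A")
proof -
  interpret A: ring ?A by (rule ring_brauer_path_algebra)
  show ?thesis
  proof (rule idealI[OF A.ring_axioms])
    show "subgroup ?N (add_monoid ?A)"
    proof (rule A.add.subgroupI)
      show "?N \<noteq> {}" by (auto intro!: exI[of _ 0])
      show "\<ominus>\<^bsub>?A\<^esub> f \<in> ?N" if "f \<in> ?N" for f
        using that a_inv_brauer_path_algebra[of f K] lin_diff[of "normal_form \<Gamma>" 0 f]
        by simp
      show "f \<oplus>\<^bsub>?A\<^esub> g \<in> ?N" if "f \<in> ?N" "g \<in> ?N" for f g
        using that keys_add[of f g] by (auto simp: lin_add)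
    qed auto
    show "g \<otimes>\<^bsub>?A\<^esub> f \<in> ?N" "f \<otimes>\<^bsub>?A\<^esub> g \<in> ?N" if "f \<in> ?N" "g \<in> carrier ?A" for f g
      using that reduce_path_times_left[of f g] reduce_path_times_right[of f g]
      by (simp_all add: quiver.path_times_in_paths)
  qed
qed

lemma normal_form_full:
  "full_path \<Gamma> as \<Longrightarrow> normal_form \<Gamma> (V, as) = Some (V, full_rep \<Gamma> V)"
  by (simp add: normal_form_def full_path_not_zero)

lemma special_cycleE:
  assumes "\<alpha> \<in> nontruncated \<Gamma>" "C \<in> special_cycles \<Gamma> \<alpha>"
  obtains j where "j < valence \<Gamma> \<alpha>" "C = run \<Gamma> \<alpha> j (valence \<Gamma> \<alpha>)" "hd C = (\<alpha>, j)"
    "tail (quiver \<Gamma>) (hd C) = successors \<Gamma> \<alpha> ! j"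
    "cycle_power C (mu \<Gamma> \<alpha>) = run \<Gamma> \<alpha> j (valence \<Gamma> \<alpha> * mu \<Gamma> \<alpha>)"
proof -
  obtain j where j: "j < valence \<Gamma> \<alpha>" "C = run \<Gamma> \<alpha> j (valence \<Gamma> \<alpha>)"
    using assms(2) unfolding special_cycles_eq by blast
  then have "hd C = (\<alpha>, j)" by (simp add: hd_run)
  then show ?thesis using that[of j] j by (simp add: cycle_power_run)
qed

text \<open>Its negation is the condition of type three. A special cycle at valence 1 is a single
  arrow and contains no path of length two, so the square of its loop has to be listed
  separately.\<close>

lemma cyc_next_iff:
  assumes "a \<in> arcs (quiver \<Gamma>)" "b \<in> arcs (quiver \<Gamma>)"
  shows "cyc_next \<Gamma> a b \<longleftrightarrow>
    (\<exists>\<alpha>\<in>nontruncated \<Gamma>. \<exists>C\<in>special_cycles \<Gamma> \<alpha>. sublist [a, b] C) \<or>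
    (\<exists>\<alpha>\<in>vertices \<Gamma>. valence \<Gamma> \<alpha> = 1 \<and> mu \<Gamma> \<alpha> > 1 \<and> a = (\<alpha>, 0) \<and> b = (\<alpha>, 0))"
    (is "_ \<longleftrightarrow> ?cycle \<or> ?loop")
proof
  obtain \<alpha> i where a: "a = (\<alpha>, i)" by fastforce
  then have \<alpha>: "\<alpha> \<in> nontruncated \<Gamma>" "i < valence \<Gamma> \<alpha>" using assms(1) by simp_all
  assume "cyc_next \<Gamma> a b"
  then have b: "b = (\<alpha>, Suc i mod valence \<Gamma> \<alpha>)" by (simp add: cyc_next_def a prod_eq_iff)
  show "?cycle \<or> ?loop"
  proof (cases "valence \<Gamma> \<alpha> = 1")
    case True
    then have "1 < mu \<Gamma> \<alpha>" using mem_nontruncated[OF nontruncatedD[OF \<alpha>(1)]] \<alpha>(1) by simp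
    then have ?loop using True \<alpha> nontruncatedD[OF \<alpha>(1)] by (intro bexI[of _ \<alpha>]) (auto simp: a b)
    then show ?thesis ..
  next
    case False
    then obtain n where n: "valence \<Gamma> \<alpha> = 2 + n"
      using \<alpha>(2) by (metis One_nat_def Suc_1 Suc_leI le_add_diff_inverse less_nat_zero_code
        nat_neq_iff less_one)
    \<comment> \<open>With valence at least 2 the pair is the beginning of the special cycle that
      starts with a.\<close>
    have "[a, b] = run \<Gamma> \<alpha> i 2"
      using \<alpha>(2) by (simp add: a b run_def upt_rec numeral_2_eq_2)
    then have "sublist [a, b] (run \<Gamma> \<alpha> i (valence \<Gamma> \<alpha>))"
      unfolding n run_add[of \<Gamma> \<alpha> i 2 n] by simp
    then have ?cycle
      using \<alpha> unfolding special_cycles_eq by blast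
    then show ?thesis ..
  qed
next
  assume "?cycle \<or> ?loop"
  then show "cyc_next \<Gamma> a b"
  proof
    assume ?cycle
    then obtain \<alpha> j where "sublist [a, b] (run \<Gamma> \<alpha> j (valence \<Gamma> \<alpha>))"
      unfolding special_cycles_eq by blast
    then obtain xs ys where "run \<Gamma> \<alpha> j (valence \<Gamma> \<alpha>) = xs @ [a, b] @ ys"
      unfolding sublist_def by blast
    then show ?thesis
      using successively_run[of \<Gamma> \<alpha> j "valence \<Gamma> \<alpha>"] by (simp add: successively_append_iff)
  qed (auto simp: cyc_next_def)
qed

text \<open>In type one both terms are full paths at V with the same normal form; in type two the
  run exceeds the bound by exactly one arrow; in type three the pair is no cyclic step.\<close>

lemma reduce_relations:
  assumes "r \<in> relations_one \<Gamma> \<union> relations_two \<Gamma> \<union> relations_three \<Gamma>"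
  shows "Poly_Mapping.keys r \<subseteq> paths (quiver \<Gamma>) \<and> reduce r = 0"
  using assms
proof (elim UnE)
  assume "r \<in> relations_one \<Gamma>"
  then obtain V \<alpha> \<beta> C D where r: "r = path_elt V (cycle_power C (mu \<Gamma> \<alpha>)) - path_elt V (cycle_power
    D (mu \<Gamma> \<beta>))"
      and \<alpha>: "\<alpha> \<in> nontruncated \<Gamma>" "C \<in> special_cycles_at \<Gamma> \<alpha> V"
      and \<beta>: "\<beta> \<in> nontruncated \<Gamma>" "D \<in> special_cycles_at \<Gamma> \<beta> V"
    unfolding relations_one_def by blast
  have *: "(V, cycle_power C (mu \<Gamma> \<alpha>)) \<in> paths (quiver \<Gamma>)" "full_path \<Gamma> (cycle_power C (mu \<Gamma> \<alpha>))"
    if C: "\<alpha> \<in> nontruncated \<Gamma>" "C \<in> special_cycles_at \<Gamma> \<alpha> V" for \<alpha> C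
  proof -
    have "C \<in> special_cycles \<Gamma> \<alpha>" and V: "tail (quiver \<Gamma>) (hd C) = V"
      using C(2) by (simp_all add: special_cycles_at_def)
    then obtain j where j: "j < valence \<Gamma> \<alpha>" "tail (quiver \<Gamma>) (hd C) = successors \<Gamma> \<alpha> ! j"
      "cycle_power C (mu \<Gamma> \<alpha>) = run \<Gamma> \<alpha> j (valence \<Gamma> \<alpha> * mu \<Gamma> \<alpha>)"
      using special_cycleE[OF C(1)] by metis
    show "(V, cycle_power C (mu \<Gamma> \<alpha>)) \<in> paths (quiver \<Gamma>)" "full_path \<Gamma> (cycle_power C (mu \<Gamma> \<alpha>))"
      using run_in_paths[OF C(1) j(1)] full_run[OF C(1)] j V by simp_all
  qed
  show ?thesis
    using keys_diff[of "path_elt V (cycle_power C (mu \<Gamma> \<alpha>))" "path_elt V (cycle_power D (mu \<Gamma> \<beta>))"]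
      *[OF \<alpha>] *[OF \<beta>] unfolding r by (auto simp: lin_diff normal_form_full)
next
  assume "r \<in> relations_two \<Gamma>"
  then obtain \<alpha> C where r: "r = path_elt (tail (quiver \<Gamma>) (hd C)) (cycle_power C (mu \<Gamma> \<alpha>) @ [hd C])"
      and \<alpha>: "\<alpha> \<in> nontruncated \<Gamma>" "C \<in> special_cycles \<Gamma> \<alpha>"
    unfolding relations_two_def by blast
  obtain j where j: "j < valence \<Gamma> \<alpha>" "hd C = (\<alpha>, j)"
      "cycle_power C (mu \<Gamma> \<alpha>) = run \<Gamma> \<alpha> j (valence \<Gamma> \<alpha> * mu \<Gamma> \<alpha>)"
    using special_cycleE[OF \<alpha>] by metis
  have "cycle_power C (mu \<Gamma> \<alpha>) @ [hd C] = run \<Gamma> \<alpha> j (valence \<Gamma> \<alpha> * mu \<Gamma> \<alpha> + 1)"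
    unfolding run_add j(3) j(2) using j(1) by (simp add: run_def)
  then have "r = path_elt (successors \<Gamma> \<alpha> ! j) (run \<Gamma> \<alpha> j (valence \<Gamma> \<alpha> * mu \<Gamma> \<alpha> + 1))"
    unfolding r j(2) by simp
  then show ?thesis
    using run_in_paths[OF \<alpha>(1) j(1)]
    by (simp add: normal_form_def zero_path_def run_bound_run)
next
  assume "r \<in> relations_three \<Gamma>"
  then obtain a b where r: "r = path_elt (tail (quiver \<Gamma>) a) [a, b]"
    and ab: "a \<in> arcs (quiver \<Gamma>)" "b \<in> arcs (quiver \<Gamma>)"
      "head (quiver \<Gamma>) a = tail (quiver \<Gamma>) b" "\<not> cyc_next \<Gamma> a b"
    unfolding relations_three_def using cyc_next_iff by blast
  have "(tail (quiver \<Gamma>) a, [a, b]) \<in> paths (quiver \<Gamma>)"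
    using ab quiver.head_in_verts[OF ab(2)]
    unfolding paths_def by (auto simp: quiver.awalk_Cons_iff quiver.awalk_Nil_iff simp del:
      verts_quiver)
  then show ?thesis
    using ab(4) unfolding r by (simp add: normal_form_def zero_path_def)
qed

text \<open>The generators lie in the kernel of \<open>reduce\<close>, which is an ideal, so
  minimality of the generated ideal gives the inclusion into the kernel.\<close>

lemma
  shows ideal_brauer_ideal: "ideal (brauer_ideal K \<Gamma>) (brauer_path_algebra K \<Gamma>)"
    and relations_in_brauer_ideal:
      "relations_one \<Gamma> \<union> relations_two \<Gamma> \<union> relations_three \<Gamma> \<subseteq> brauer_ideal K \<Gamma>"
    and reduce_brauer_ideal: "f \<in> brauer_ideal K \<Gamma> \<Longrightarrow> reduce f = 0"
proof -
  interpret A: ring "brauer_path_algebra K \<Gamma>" by (rule ring_brauer_path_algebra)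
  have sub: "relations_one \<Gamma> \<union> relations_two \<Gamma> \<union> relations_three \<Gamma>
    \<subseteq> carrier (brauer_path_algebra K \<Gamma>)"
    using reduce_relations by auto
  show "ideal (brauer_ideal K \<Gamma>) (brauer_path_algebra K \<Gamma>)"
    unfolding brauer_ideal_def by (rule A.genideal_ideal[OF sub])
  show "relations_one \<Gamma> \<union> relations_two \<Gamma> \<union> relations_three \<Gamma> \<subseteq> brauer_ideal K \<Gamma>"
    unfolding brauer_ideal_def by (rule A.genideal_self[OF sub])
  have "brauer_ideal K \<Gamma> \<subseteq> {f. Poly_Mapping.keys f \<subseteq> paths (quiver \<Gamma>) \<and> reduce f = 0}"
    unfolding brauer_ideal_def
    by (rule A.genideal_minimal[OF ideal_reduce_kernel]) (use reduce_relations in blast)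
  then show "f \<in> brauer_ideal K \<Gamma> \<Longrightarrow> reduce f = 0" by blast
qed

text \<open>Multiply the relation by the remaining pieces of the path on both sides; the left piece
  also carries the scalar c.\<close>

lemma subpath_in_brauer_ideal:
  assumes rel: "path_elt (path_end (quiver \<Gamma>) (u, xs)) as \<in> brauer_ideal K \<Gamma>"
    and path: "(u, xs @ as @ ys) \<in> paths (quiver \<Gamma>)"
  shows "Poly_Mapping.single (u, xs @ as @ ys) c \<in> brauer_ideal K \<Gamma>"
proof -
  let ?A = "brauer_path_algebra K \<Gamma>" and ?Q = "quiver \<Gamma>"
  interpret I: ideal "brauer_ideal K \<Gamma>" ?A by (rule ideal_brauer_ideal)
  let ?v = "path_end ?Q (u, xs)" and ?w = "path_end ?Q (path_end ?Q (u, xs), as)"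
  have "(u, xs) \<in> paths ?Q" "(?w, ys) \<in> paths ?Q"
    using path unfolding paths_def by (auto simp: path_end_def)
  then have carr: "Poly_Mapping.single (u, xs) c \<in> carrier ?A" "path_elt ?w ys \<in> carrier ?A"
    by (auto simp: )
  have "Poly_Mapping.single (u, xs) c \<otimes>\<^bsub>?A\<^esub> (path_elt ?v as \<otimes>\<^bsub>?A\<^esub> path_elt ?w ys) \<in> brauer_ideal K
    \<Gamma>"
    by (intro I.I_l_closed I.I_r_closed rel carr)
  then show ?thesis by (simp add: path_comp_def)
qed

text \<open>An overlong run begins with the type two relation of the special cycle starting at its
  first arrow; otherwise some two consecutive arrows form a type three relation.\<close>

lemma zero_path_in_brauer_ideal:
  assumes "(u, as) \<in> paths (quiver \<Gamma>)" "zero_path \<Gamma> as"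
  shows "Poly_Mapping.single (u, as) c \<in> brauer_ideal K \<Gamma>"
proof (cases "successively (cyc_next \<Gamma>) as")
  case True
  have "as \<noteq> []" "run_bound \<Gamma> as < length as" using assms(2) True by (simp_all add: zero_path_def)
  then obtain \<alpha> j where run: "\<alpha> \<in> nontruncated \<Gamma>" "j < valence \<Gamma> \<alpha>" "u = successors \<Gamma> \<alpha> ! j"
    "as = run \<Gamma> \<alpha> j (length as)" "valence \<Gamma> \<alpha> * mu \<Gamma> \<alpha> < length as"
    using path_runE[OF assms(1) _ True] by metis
  let ?n = "valence \<Gamma> \<alpha> * mu \<Gamma> \<alpha> + 1" and ?C = "run \<Gamma> \<alpha> j (valence \<Gamma> \<alpha>)"
  have C: "?C \<in> special_cycles \<Gamma> \<alpha>" "hd ?C = (\<alpha>, j)"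
    using run(2) by (auto simp: special_cycles_eq hd_run)
  have "path_elt (tail (quiver \<Gamma>) (hd ?C)) (cycle_power ?C (mu \<Gamma> \<alpha>) @ [hd ?C]) \<in> relations_two \<Gamma>"
    using run(1) C(1) unfolding relations_two_def by blast
  moreover have "cycle_power ?C (mu \<Gamma> \<alpha>) @ [hd ?C] = run \<Gamma> \<alpha> j ?n"
    unfolding run_add cycle_power_run C(2) using run(2) by (simp add: run_def)
  ultimately have "path_elt u (run \<Gamma> \<alpha> j ?n) \<in> relations_two \<Gamma>"
    using run(3) C(2) by simp
  then have rel: "path_elt u (run \<Gamma> \<alpha> j ?n) \<in> brauer_ideal K \<Gamma>"
    using relations_in_brauer_ideal by blast
  obtain k where k: "length as = ?n + k"
    using run(5) by (metis Suc_eq_plus1 Suc_leI le_Suc_ex)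
  have "as = [] @ run \<Gamma> \<alpha> j ?n @ run \<Gamma> \<alpha> (j + ?n) k"
    by (subst run(4)) (simp only: k run_add append_Nil append_assoc)
  then show ?thesis
    using subpath_in_brauer_ideal[of u "[]"] rel assms(1) by (simp add: path_end_eq)
next
  case False
  then obtain xs a b ys where as: "as = xs @ a # b # ys" "\<not> cyc_next \<Gamma> a b"
    by (rule not_successivelyE)
  have walk: "a \<in> arcs (quiver \<Gamma>)" "b \<in> arcs (quiver \<Gamma>)" "head (quiver \<Gamma>) a = tail (quiver \<Gamma>) b"
      "path_end (quiver \<Gamma>) (u, xs) = tail (quiver \<Gamma>) a"
    using assms(1) unfolding paths_def as by (auto simp: quiver.awalk_Cons_iff path_end_def)
  then have "path_elt (tail (quiver \<Gamma>) a) [a, b] \<in> relations_three \<Gamma>"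
    using as(2) cyc_next_iff[OF walk(1,2)] unfolding relations_three_def by blast
  then have "path_elt (path_end (quiver \<Gamma>) (u, xs)) [a, b] \<in> brauer_ideal K \<Gamma>"
    using relations_in_brauer_ideal walk(4) by auto
  then show ?thesis
    using subpath_in_brauer_ideal[of u xs "[a, b]" K ys] assms(1) as(1) by simp
qed

lemma full_path_cycle_power:
  assumes "(V, as) \<in> paths (quiver \<Gamma>)" "full_path \<Gamma> as"
  obtains \<alpha> C where "\<alpha> \<in> nontruncated \<Gamma>" "\<alpha> \<in># polygon \<Gamma> V" "C \<in> special_cycles_at \<Gamma> \<alpha> V"
    "as = cycle_power C (mu \<Gamma> \<alpha>)"
proof -
  have *: "as \<noteq> []" "successively (cyc_next \<Gamma>) as" "length as = run_bound \<Gamma> as"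
    using assms(2) by (simp_all add: full_path_def)
  obtain \<alpha> j where run: "\<alpha> \<in> nontruncated \<Gamma>" "j < valence \<Gamma> \<alpha>" "V = successors \<Gamma> \<alpha> ! j"
    "as = run \<Gamma> \<alpha> j (length as)" "run_bound \<Gamma> as = valence \<Gamma> \<alpha> * mu \<Gamma> \<alpha>"
    using path_runE[OF assms(1) *(1,2)] by metis
  have "run \<Gamma> \<alpha> j (valence \<Gamma> \<alpha>) \<in> special_cycles_at \<Gamma> \<alpha> V"
    using run(2,3) by (auto simp: special_cycles_at_def special_cycles_eq hd_run)
  moreover have "as = cycle_power (run \<Gamma> \<alpha> j (valence \<Gamma> \<alpha>)) (mu \<Gamma> \<alpha>)"
    using run(4,5) *(3) by (simp add: cycle_power_run)
  moreover have "\<alpha> \<in># polygon \<Gamma> V"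
    using successors_eq_imp_mem[OF run(1,2)] run(3) by simp
  ultimately show ?thesis using that run(1) by blast
qed

text \<open>Both full paths are powers of special cycles at V, so their difference is a type one
  relation; left multiplication by c times the trivial path at V inserts the scalar.\<close>

lemma full_path_diff_in_brauer_ideal:
  assumes "(V, as) \<in> paths (quiver \<Gamma>)" "full_path \<Gamma> as"
  shows "Poly_Mapping.single (V, as) c - Poly_Mapping.single (V, full_rep \<Gamma> V) c \<in> brauer_ideal K \<Gamma>"
proof -
  let ?A = "brauer_path_algebra K \<Gamma>"
  interpret I: ideal "brauer_ideal K \<Gamma>" ?A by (rule ideal_brauer_ideal)
  have V: "V \<in> polygons \<Gamma>" using quiver.fst_path_in_verts[OF assms(1)] by simp
  have "path_elt V as - path_elt V (full_rep \<Gamma> V) \<in> relations_one \<Gamma>"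
  proof -
    obtain \<alpha> C where "\<alpha> \<in> nontruncated \<Gamma>" "\<alpha> \<in># polygon \<Gamma> V" "C \<in> special_cycles_at \<Gamma> \<alpha> V"
      "as = cycle_power C (mu \<Gamma> \<alpha>)" using full_path_cycle_power[OF assms] .
    moreover obtain \<beta> D where "\<beta> \<in> nontruncated \<Gamma>" "\<beta> \<in># polygon \<Gamma> V" "D \<in> special_cycles_at \<Gamma> \<beta> V"
      "full_rep \<Gamma> V = cycle_power D (mu \<Gamma> \<beta>)" using full_path_cycle_power[OF full_rep[OF V]] .
    ultimately have "path_elt V (cycle_power C (mu \<Gamma> \<alpha>)) - path_elt V (cycle_power D (mu \<Gamma> \<beta>)) \<in>
      relations_one \<Gamma>"
      using V unfolding relations_one_def by blast
    then show ?thesis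
      using \<open>as = _\<close> \<open>full_rep \<Gamma> V = _\<close> by simp
  qed
  then have "path_elt V as - path_elt V (full_rep \<Gamma> V) \<in> brauer_ideal K \<Gamma>"
    using relations_in_brauer_ideal by blast
  moreover have "Poly_Mapping.single (V, []) c \<in> carrier ?A"
    using V by (auto simp: quiver.trivial_in_paths)
  ultimately have "Poly_Mapping.single (V, []) c \<otimes>\<^bsub>?A\<^esub> (path_elt V as - path_elt V (full_rep \<Gamma> V)) \<in>
    brauer_ideal K \<Gamma>"
    by (rule I.I_l_closed)
  then show ?thesis by (simp add: path_times_diff_right path_comp_def path_end_eq)
qed

text \<open>Gives the converse inclusion: if \<open>reduce f = 0\<close>, then f itself is this
  difference.\<close>

lemma diff_reduce_in_brauer_ideal:
  assumes "Poly_Mapping.keys f \<subseteq> paths (quiver \<Gamma>)"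
  shows "f - reduce f \<in> brauer_ideal K \<Gamma>"
proof -
  interpret I: ideal "brauer_ideal K \<Gamma>" "brauer_path_algebra K \<Gamma>" by (rule ideal_brauer_ideal)
  have zero_in: "0 \<in> brauer_ideal K \<Gamma>"
    using additive_subgroup.zero_closed[OF I.is_additive_subgroup]
      by (simp only: brauer_path_algebra_simps)
  show ?thesis
    using assms
  proof (induction f rule: poly_mapping_keys_induct)
    case zero
    then show ?case using zero_in by simp
  next
    case (single p c)
    obtain V as where p: "p = (V, as)" by fastforce
    show ?case
      using single zero_path_in_brauer_ideal[of V as] full_path_diff_in_brauer_ideal[of V as]
        zero_in
      unfolding p by (auto simp: normal_form_def)
  next
    case (add f g)
    then show ?case
      using additive_subgroup.a_closed[OF I.is_additive_subgroup, of "f - reduce f" "g - reduce g"]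
      by (simp add: lin_add add_diff_add)
  qed
qed

lemma mem_brauer_ideal_iff:
  assumes "Poly_Mapping.keys f \<subseteq> paths (quiver \<Gamma>)"
  shows "f \<in> brauer_ideal K \<Gamma> \<longleftrightarrow> reduce f = 0"
  using reduce_brauer_ideal diff_reduce_in_brauer_ideal[OF assms] by auto

end


section \<open>The projective module of a polygon\<close>

lemma (in ring) subgroup_principal:
  assumes "e \<in> carrier R"
  shows "subgroup {e \<otimes> x |x. x \<in> carrier R} (add_monoid R)"
proof (rule add.subgroupI)
  show "{e \<otimes> x |x. x \<in> carrier R} \<subseteq> carrier R" using assms by auto
  show "{e \<otimes> x |x. x \<in> carrier R} \<noteq> {}" by auto
  show "\<ominus> a \<in> {e \<otimes> x |x. x \<in> carrier R}" if "a \<in> {e \<otimes> x |x. x \<in> carrier R}" for a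
    using that assms by (auto simp: r_minus[symmetric])
  show "a \<oplus> b \<in> {e \<otimes> x |x. x \<in> carrier R}"
    if "a \<in> {e \<otimes> x |x. x \<in> carrier R}" "b \<in> {e \<otimes> x |x. x \<in> carrier R}" for a b
    using that assms by (auto simp: r_distr[symmetric])
qed

lemma principal_right_module_simps [simp]:
  "carrier (principal_right_module R e) = {e \<otimes>\<^bsub>R\<^esub> x |x. x \<in> carrier R}"
  "add (principal_right_module R e) = add R"
  "zero (principal_right_module R e) = zero R"
  "smult (principal_right_module R e) = (\<lambda>a x. x \<otimes>\<^bsub>R\<^esub> a)"
  by (simp_all add: principal_right_module_def)

lemma (in ring) right_module_principal:
  assumes e: "e \<in> carrier R"
  shows "right_module R (principal_right_module R e)"
proof -
  let ?M = "principal_right_module R e" and ?H = "{e \<otimes> x |x. x \<in> carrier R}"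
  have H: "?H \<subseteq> carrier R" "\<zero> \<in> ?H" "\<And>x y. x \<in> ?H \<Longrightarrow> y \<in> ?H \<Longrightarrow> x \<oplus> y \<in> ?H" "\<And>x. x \<in> ?H \<Longrightarrow> \<ominus> x \<in> ?H"
    using additive_subgroup.a_subset[OF additive_subgroupI[OF subgroup_principal[OF e]]]
      additive_subgroup.zero_closed[OF additive_subgroupI[OF subgroup_principal[OF e]]]
      additive_subgroup.a_closed[OF additive_subgroupI[OF subgroup_principal[OF e]]]
      additive_subgroup.a_inv_closed[OF additive_subgroupI[OF subgroup_principal[OF e]]] by blast+
  interpret M: abelian_group ?M
  proof (rule abelian_groupI)
    show "\<exists>y\<in>carrier ?M. y \<oplus>\<^bsub>?M\<^esub> x = \<zero>\<^bsub>?M\<^esub>" if "x \<in> carrier ?M" for x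
      using that H(1) H(4)[of x] l_neg[of x] by (intro bexI[of _ "\<ominus> x"]) auto
  qed (unfold principal_right_module_simps, use H in \<open>simp_all add: subset_iff a_ac del:
    mem_Collect_eq\<close>)
  show ?thesis
    by unfold_locales (use e in \<open>auto simp: l_distr\<close>)
qed

lemma (in ring) right_submodule_principal_iff:
  assumes e: "e \<in> carrier R"
  shows "right_submodule R (principal_right_module R e) N \<longleftrightarrow>
    additive_subgroup N R \<and> N \<subseteq> {e \<otimes> x |x. x \<in> carrier R} \<and> (\<forall>a\<in>carrier R. \<forall>x\<in>N. x \<otimes> a \<in> N)"
    (is "_ \<longleftrightarrow> ?R")
proof -
  let ?M = "principal_right_module R e" and ?H = "{e \<otimes> x |x. x \<in> carrier R}"
  interpret M: right_module R ?M by (rule right_module_principal[OF e])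
  have H: "?H \<subseteq> carrier R" "\<And>x. x \<in> ?H \<Longrightarrow> \<ominus> x \<in> ?H"
    using additive_subgroup.a_subset[OF additive_subgroupI[OF subgroup_principal[OF e]]]
      additive_subgroup.a_inv_closed[OF additive_subgroupI[OF subgroup_principal[OF e]]] by blast+
  \<comment> \<open>The negative in the module is defined relative to its own smaller carrier;
    uniqueness of inverses identifies it with the one of the ring.\<close>
  have inv: "\<ominus>\<^bsub>?M\<^esub> x = \<ominus> x" if "x \<in> ?H" for x
    by (rule M.minus_equality) (use that H l_neg[of x] in \<open>auto simp del: mem_Collect_eq\<close>)
  have "additive_subgroup N ?M \<longleftrightarrow> additive_subgroup N R \<and> N \<subseteq> ?H"
  proof
    assume N: "additive_subgroup N ?M"
    then have sub: "N \<subseteq> ?H" using additive_subgroup.a_subset by fastforce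
    have "subgroup N (add_monoid R)"
    proof (rule add.subgroupI)
      show "N \<subseteq> carrier R" using sub H(1) by blast
      show "N \<noteq> {}" using additive_subgroup.zero_closed[OF N] by blast
      show "\<ominus> x \<in> N" if "x \<in> N" for x
        using additive_subgroup.a_inv_closed[OF N that] inv[OF subsetD[OF sub that]] by simp
      show "x \<oplus> y \<in> N" if "x \<in> N" "y \<in> N" for x y
        using additive_subgroup.a_closed[OF N that] by simp
    qed
    with sub show "additive_subgroup N R \<and> N \<subseteq> ?H" by (simp add: additive_subgroupI)
  next
    assume N: "additive_subgroup N R \<and> N \<subseteq> ?H"
    have "subgroup N (add_monoid ?M)"
    proof (rule M.add.subgroupI)
      show "N \<subseteq> carrier ?M" using N by simp
      show "N \<noteq> {}" using N additive_subgroup.zero_closed by blast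
      show "\<ominus>\<^bsub>?M\<^esub> x \<in> N" if "x \<in> N" for x
        using N inv[of x] subsetD[of N ?H x] that additive_subgroup.a_inv_closed[of N R x]
          by presburger
      show "x \<oplus>\<^bsub>?M\<^esub> y \<in> N" if "x \<in> N" "y \<in> N" for x y
        using N additive_subgroup.a_closed[of N R x y] that by simp
    qed
    then show "additive_subgroup N ?M" by (rule additive_subgroupI)
  qed
  then show ?thesis unfolding right_submodule_def by auto
qed

lemma path_times_single_left: "path_times G (Poly_Mapping.single p 1) f = lin (path_comp G p) f"
  by (simp add: path_times_eq lin_def)

lemma lin_sum: "lin F (\<Sum>i\<in>S. f i) = (\<Sum>i\<in>S. lin F (f i))"
  by (induction S rule: infinite_finite_induct) (simp_all add: lin_add)

text \<open>Every initial segment of a sorted list contains all elements of strictly smaller key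
  than one of its members; this will make initial segments of the basis stable under
  multiplication.\<close>

lemma in_set_take_sort_key:
  assumes xs: "p \<in> set (take k (sort_key h xs))" and q: "q \<in> set xs" and h: "h q < h p"
  shows "q \<in> set (take k (sort_key h xs))"
proof -
  let ?ys = "sort_key h xs"
  obtain i where i: "i < length ?ys" "i < k" "?ys ! i = p"
    using xs by (auto simp: in_set_conv_nth)
  obtain j where j: "j < length ?ys" "?ys ! j = q"
    using q by (metis in_set_conv_nth set_sort)
  have "j < i"
  proof (rule ccontr)
    assume "\<not> j < i"
    then have "map h ?ys ! i \<le> map h ?ys ! j"
      using j(1) by (intro sorted_nth_mono sorted_sort_key) simp_all
    then show False using i j h by simp
  qed
  then show ?thesis
    using i(2) j by (auto simp: in_set_conv_nth intro!: exI[of _ j])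
qed

section \<open>Basis, cosets and their spans\<close>

context brauer_configuration
begin

definition basis :: "'l \<Rightarrow> ('l, 'a \<times> nat) path set" where
  "basis V = {p \<in> paths (quiver \<Gamma>). fst p = V \<and> normal_form \<Gamma> p = Some p}"

abbreviation coset :: "'k::field itself \<Rightarrow> (('l, 'a \<times> nat) path \<Rightarrow>\<^sub>0 'k) \<Rightarrow> (('l, 'a \<times> nat) path \<Rightarrow>\<^sub>0
  'k) set" where
  "coset K f \<equiv> brauer_ideal K \<Gamma> +>\<^bsub>brauer_path_algebra K \<Gamma>\<^esub> f"

definition basis_span :: "'k::field itself \<Rightarrow> ('l, 'a \<times> nat) path set \<Rightarrow> (('l, 'a \<times> nat) path \<Rightarrow>\<^sub>0 'k)
  set set" where
  "basis_span K S = coset K ` {f. Poly_Mapping.keys f \<subseteq> S}"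

lemma ring_brauer_algebra: "ring (brauer_algebra K \<Gamma>)"
  unfolding brauer_algebra_def by (rule ideal.quotient_is_ring[OF ideal_brauer_ideal])

lemma coset_eq_iff:
  assumes "Poly_Mapping.keys f \<subseteq> paths (quiver \<Gamma>)" "Poly_Mapping.keys g \<subseteq> paths (quiver \<Gamma>)"
  shows "coset K f = coset K g \<longleftrightarrow> reduce f = reduce g"
proof -
  interpret A: ring "brauer_path_algebra K \<Gamma>" by (rule ring_brauer_path_algebra)
  have "f \<ominus>\<^bsub>brauer_path_algebra K \<Gamma>\<^esub> g = f - g"
    using a_inv_brauer_path_algebra[of g K] assms by (simp add: a_minus_def)
  moreover have "Poly_Mapping.keys (f - g) \<subseteq> paths (quiver \<Gamma>)"
    using keys_diff[of f g] assms by blast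
  ultimately show ?thesis
    using A.quotient_eq_iff_same_a_r_cos[OF ideal_brauer_ideal, of f g] mem_brauer_ideal_iff[of "f -
      g" K] assms
    by (simp add: lin_diff)
qed

lemma carrier_brauer_algebra: "carrier (brauer_algebra K \<Gamma>) = coset K ` {f. Poly_Mapping.keys f
  \<subseteq> paths (quiver \<Gamma>)}"
  unfolding brauer_algebra_def by (auto simp: FactRing_def A_RCOSETS_def')

lemma
  assumes "Poly_Mapping.keys f \<subseteq> paths (quiver \<Gamma>)" "Poly_Mapping.keys g \<subseteq> paths (quiver \<Gamma>)"
  shows mult_coset: "coset K f \<otimes>\<^bsub>brauer_algebra K \<Gamma>\<^esub> coset K g
    = coset K (path_times (quiver \<Gamma>) f g)"
    and add_coset: "coset K f \<oplus>\<^bsub>brauer_algebra K \<Gamma>\<^esub> coset K g = coset K (f + g)"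
proof -
  interpret h: ring_hom_ring "brauer_path_algebra K \<Gamma>" "brauer_algebra K \<Gamma>" "coset K"
    unfolding brauer_algebra_def by (rule ideal.rcos_ring_hom_ring[OF ideal_brauer_ideal])
  show "coset K f \<otimes>\<^bsub>brauer_algebra K \<Gamma>\<^esub> coset K g = coset K (path_times (quiver \<Gamma>) f g)"
    using h.hom_mult[of f g] assms by simp
  show "coset K f \<oplus>\<^bsub>brauer_algebra K \<Gamma>\<^esub> coset K g = coset K (f + g)"
    using h.hom_add[of f g] assms by simp
qed

lemma zero_coset: "\<zero>\<^bsub>brauer_algebra K \<Gamma>\<^esub> = coset K 0"
proof -
  interpret h: ring_hom_ring "brauer_path_algebra K \<Gamma>" "brauer_algebra K \<Gamma>" "coset K"
    unfolding brauer_algebra_def by (rule ideal.rcos_ring_hom_ring[OF ideal_brauer_ideal])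
  show ?thesis using h.hom_zero by simp
qed

lemma minus_coset:
  assumes "Poly_Mapping.keys f \<subseteq> paths (quiver \<Gamma>)"
  shows "\<ominus>\<^bsub>brauer_algebra K \<Gamma>\<^esub> coset K f = coset K (- f)"
proof -
  interpret h: ring_hom_ring "brauer_path_algebra K \<Gamma>" "brauer_algebra K \<Gamma>" "coset K"
    unfolding brauer_algebra_def by (rule ideal.rcos_ring_hom_ring[OF ideal_brauer_ideal])
  show ?thesis using h.hom_a_inv[of f] a_inv_brauer_path_algebra[of f K] assms by simp
qed

lemma basis_subset: "basis V \<subseteq> paths (quiver \<Gamma>)"
  by (auto simp: basis_def)

lemma reduce_basis: "Poly_Mapping.keys f \<subseteq> basis V \<Longrightarrow> reduce f = f"
  by (rule lin_id) (auto simp: basis_def)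

text \<open>Independence modulo the ideal: \<open>reduce\<close> is constant on cosets and fixes
  combinations of basis paths.\<close>

lemma coset_basis_inj:
  assumes "Poly_Mapping.keys f \<subseteq> basis V" "Poly_Mapping.keys g \<subseteq> basis V" "coset K f = coset K g"
  shows "f = g"
  using assms coset_eq_iff[of f g K] reduce_basis basis_subset by (metis order_trans)

lemma coset_in_basis_span_iff:
  assumes "Poly_Mapping.keys f \<subseteq> basis V" "S \<subseteq> basis V"
  shows "coset K f \<in> basis_span K S \<longleftrightarrow> Poly_Mapping.keys f \<subseteq> S"
  using coset_basis_inj[OF assms(1)] assms(2) unfolding basis_span_def by blast

lemma vertex_idem_carrier: "V \<in> polygons \<Gamma> \<Longrightarrow> vertex_idem K \<Gamma> V \<in> carrier (brauer_algebra K \<Gamma>)"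
  by (auto simp: vertex_idem_def carrier_brauer_algebra quiver.trivial_in_paths)

lemma carrier_projective:
  fixes K :: "'k::field itself"
  assumes V: "V \<in> polygons \<Gamma>"
  shows "{vertex_idem K \<Gamma> V \<otimes>\<^bsub>brauer_algebra K \<Gamma>\<^esub> x |x. x \<in> carrier (brauer_algebra K \<Gamma>)}
    = basis_span K (basis V)"
    (is "?H = _")
proof
  have e: "Poly_Mapping.keys (path_elt V [] :: _ \<Rightarrow>\<^sub>0 'k) \<subseteq> paths (quiver \<Gamma>)"
    using V by (simp add: quiver.trivial_in_paths)
  show "?H \<subseteq> basis_span K (basis V)"
  proof
    fix y assume "y \<in> ?H"
    then obtain f where f: "Poly_Mapping.keys f \<subseteq> paths (quiver \<Gamma>)" "y
      = vertex_idem K \<Gamma> V \<otimes>\<^bsub>brauer_algebra K \<Gamma>\<^esub> coset K f"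
      unfolding carrier_brauer_algebra by blast
    let ?g = "path_times (quiver \<Gamma>) (path_elt V []) f"
    have g: "Poly_Mapping.keys ?g \<subseteq> {p \<in> paths (quiver \<Gamma>). fst p = V}"
    proof -
      have "Poly_Mapping.keys ?g \<subseteq> {p. fst p = V}"
        unfolding path_times_single_left by (rule keys_lin_subset) (auto simp: path_comp_def split:
          if_splits)
      then show ?thesis using quiver.path_times_in_paths[OF e f(1)] by blast
    qed
    have red: "Poly_Mapping.keys (reduce ?g) \<subseteq> basis V"
    proof (rule keys_lin_subset)
      fix p q assume "p \<in> Poly_Mapping.keys ?g" and q: "normal_form \<Gamma> p = Some q"
      then have p: "p \<in> paths (quiver \<Gamma>)" "fst p = V" using g by auto
      show "q \<in> basis V"
        using p normal_form_in_paths[OF p(1) q] path_end_normal_form(2)[OF p(1) q]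
          normal_form_idem[OF p(1) q]
        by (simp add: basis_def)
    qed
    have "y = coset K ?g" using f mult_coset[OF e f(1), of K] by (simp add: vertex_idem_def)
    \<comment> \<open>The reduced element is supported on the basis and hence fixed by
      \<open>reduce\<close>, so both sides have equal reductions.\<close>
    also have "\<dots> = coset K (reduce ?g)"
      using g red basis_subset reduce_basis[OF red] by (subst coset_eq_iff) auto
    finally show "y \<in> basis_span K (basis V)"
      using red unfolding basis_span_def by blast
  qed
  show "basis_span K (basis V) \<subseteq> ?H"
  proof
    fix y assume "y \<in> basis_span K (basis V)"
    then obtain f where f: "Poly_Mapping.keys f \<subseteq> basis V" "y = coset K f"
      unfolding basis_span_def by blast
    have fp: "Poly_Mapping.keys f \<subseteq> paths (quiver \<Gamma>)" using f(1) basis_subset by blast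
    have "path_times (quiver \<Gamma>) (path_elt V []) f = f"
      unfolding path_times_single_left
      by (rule lin_id) (use f(1) in \<open>auto simp: path_comp_def path_end_eq basis_def\<close>)
    then have "vertex_idem K \<Gamma> V \<otimes>\<^bsub>brauer_algebra K \<Gamma>\<^esub> coset K f = y"
      using mult_coset[OF e fp, of K] f(2) by (simp add: vertex_idem_def)
    then show "y \<in> ?H" using fp unfolding carrier_brauer_algebra by blast
  qed
qed

text \<open>The condition on basis paths under which \<open>basis_span K S\<close> is stable under
  right multiplication; products that vanish impose nothing.\<close>

definition path_closed :: "('l, 'a \<times> nat) path set \<Rightarrow> bool" where
  "path_closed S \<longleftrightarrow> (\<forall>p\<in>S. \<forall>q\<in>paths (quiver \<Gamma>). \<forall>r.
     Option.bind (path_comp (quiver \<Gamma>) p q) (normal_form \<Gamma>) = Some r \<longrightarrow> r \<in> S)"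

lemma keys_reduce_path_times:
  assumes "path_closed S" "Poly_Mapping.keys f \<subseteq> S" "Poly_Mapping.keys g \<subseteq> paths (quiver \<Gamma>)"
  shows "Poly_Mapping.keys (reduce (path_times (quiver \<Gamma>) f g)) \<subseteq> S"
proof -
  have "Poly_Mapping.keys (opt_single (Option.bind (path_comp (quiver \<Gamma>) p q) (normal_form \<Gamma>)) c)
    \<subseteq> S"
    if "p \<in> Poly_Mapping.keys f" "q \<in> Poly_Mapping.keys g" for p q c
    using assms that unfolding path_closed_def
    by (cases "Option.bind (path_comp (quiver \<Gamma>) p q) (normal_form \<Gamma>)") auto
  then show ?thesis
    unfolding path_times_eq lin_sum lin_opt_single by (intro order_trans[OF keys_sum] UN_least)
qed

text \<open>A product of representatives may have support outside S, but reducing it keeps the coset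
  and, by \<open>keys_reduce_path_times\<close>, moves the support back into S.\<close>

lemma right_submodule_basis_span:
  assumes V: "V \<in> polygons \<Gamma>" and S: "S \<subseteq> basis V" "path_closed S"
  shows "right_submodule (brauer_algebra K \<Gamma>) (principal_right_module (brauer_algebra K \<Gamma>)
    (vertex_idem K \<Gamma> V)) (basis_span K S)"
proof -
  interpret L: ring "brauer_algebra K \<Gamma>" by (rule ring_brauer_algebra)
  have Sp: "S \<subseteq> paths (quiver \<Gamma>)" using S(1) basis_subset by blast
  have "subgroup (basis_span K S) (add_monoid (brauer_algebra K \<Gamma>))"
  proof (rule L.add.subgroupI)
    show "basis_span K S \<subseteq> carrier (brauer_algebra K \<Gamma>)"
      using Sp unfolding basis_span_def carrier_brauer_algebra by blast
    show "basis_span K S \<noteq> {}" unfolding basis_span_def by (auto intro!: exI[of _ 0])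
    show "\<ominus>\<^bsub>brauer_algebra K \<Gamma>\<^esub> x \<in> basis_span K S" if "x \<in> basis_span K S" for x
    proof -
      obtain f where f: "Poly_Mapping.keys f \<subseteq> S" "x = coset K f" using \<open>x \<in> _\<close>
        unfolding basis_span_def by blast
      then have "\<ominus>\<^bsub>brauer_algebra K \<Gamma>\<^esub> x = coset K (- f)" using minus_coset[of f K] Sp by auto
      then show ?thesis using f unfolding basis_span_def by auto
    qed
    show "x \<oplus>\<^bsub>brauer_algebra K \<Gamma>\<^esub> y \<in> basis_span K S" if "x \<in> basis_span K S" "y \<in> basis_span K S"
      for x y
    proof -
      obtain f g where f: "Poly_Mapping.keys f \<subseteq> S" "x = coset K f"
        and g: "Poly_Mapping.keys g \<subseteq> S" "y = coset K g"
        using \<open>x \<in> _\<close> \<open>y \<in> _\<close> unfolding basis_span_def by blast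
      then have "x \<oplus>\<^bsub>brauer_algebra K \<Gamma>\<^esub> y = coset K (f + g)" using add_coset[of f g K] Sp by auto
      moreover have "Poly_Mapping.keys (f + g) \<subseteq> S" using f g keys_add[of f g] by blast
      ultimately show ?thesis unfolding basis_span_def by blast
    qed
  qed
  moreover have "x \<otimes>\<^bsub>brauer_algebra K \<Gamma>\<^esub> a \<in> basis_span K S"
    if x: "x \<in> basis_span K S" and a: "a \<in> carrier (brauer_algebra K \<Gamma>)" for x a
  proof -
    obtain f g where f: "Poly_Mapping.keys f \<subseteq> S" "x = coset K f"
        and g: "Poly_Mapping.keys g \<subseteq> paths (quiver \<Gamma>)" "a = coset K g"
      using x a unfolding basis_span_def carrier_brauer_algebra by blast
    have fp: "Poly_Mapping.keys f \<subseteq> paths (quiver \<Gamma>)" using f(1) Sp by blast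
    let ?h = "path_times (quiver \<Gamma>) f g"
    have h: "Poly_Mapping.keys (reduce ?h) \<subseteq> S" by (rule keys_reduce_path_times[OF S(2) f(1) g(1)])
    have "reduce (reduce ?h) = reduce ?h" using h S(1) by (intro reduce_basis) blast
    then have "coset K ?h = coset K (reduce ?h)"
      using quiver.path_times_in_paths[OF fp g(1)] keys_reduce by (subst coset_eq_iff) auto
    then show ?thesis
      using mult_coset[OF fp g(1), of K] f(2) g(2) h unfolding basis_span_def by auto
  qed
  moreover have "basis_span K S \<subseteq> basis_span K (basis V)"
    using S(1) unfolding basis_span_def by blast
  ultimately show ?thesis
    unfolding L.right_submodule_principal_iff[OF vertex_idem_carrier[OF V]] carrier_projective[OF V]
    by (simp add: additive_subgroup_def)
qed

text \<open>An element of N outside the smaller span has a nonzero coefficient at b. Cancelling its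
  other terms, which lie in the smaller span, leaves a multiple of b; rescaling yields all multiples
  of b.\<close>

lemma basis_span_insert_simple:
  fixes K :: "'k::field itself"
  assumes V: "V \<in> polygons \<Gamma>" and S: "insert b S \<subseteq> basis V"
    and N: "right_submodule (brauer_algebra K \<Gamma>) (principal_right_module (brauer_algebra K \<Gamma>)
      (vertex_idem K \<Gamma> V)) N"
    and sub: "basis_span K S \<subset> N" "N \<subseteq> basis_span K (insert b S)"
  shows "N = basis_span K (insert b S)"
proof -
  let ?L = "brauer_algebra K \<Gamma>"
  interpret L: ring ?L by (rule ring_brauer_algebra)
  have Np: "additive_subgroup N ?L" "\<And>a x. a \<in> carrier ?L \<Longrightarrow> x \<in> N \<Longrightarrow> x \<otimes>\<^bsub>?L\<^esub> a \<in> N"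
    using N unfolding L.right_submodule_principal_iff[OF vertex_idem_carrier[OF V]] by blast+
  have b: "b \<in> paths (quiver \<Gamma>)" using S basis_subset by blast
  have keys: "Poly_Mapping.keys f \<subseteq> paths (quiver \<Gamma>)" if "Poly_Mapping.keys f \<subseteq> insert b S"
    for f :: "_ \<Rightarrow>\<^sub>0 'k"
    using that S basis_subset by blast
  have split: "Poly_Mapping.keys (f - Poly_Mapping.single b (Poly_Mapping.lookup f b)) \<subseteq> S"
    if "Poly_Mapping.keys f \<subseteq> insert b S" for f :: "_ \<Rightarrow>\<^sub>0 'k"
    using that by (auto simp: in_keys_iff lookup_minus lookup_single when_def split: if_splits)
  obtain x where x: "x \<in> N" "x \<notin> basis_span K S" using sub(1) by blast
  then have "x \<in> basis_span K (insert b S)" using sub(2) by blast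
  then obtain f where f: "x = coset K f" "Poly_Mapping.keys f \<subseteq> insert b S"
    unfolding basis_span_def by blast
  define c where "c = Poly_Mapping.lookup f b"
  define f' where "f' = f - Poly_Mapping.single b c"
  have f': "Poly_Mapping.keys f' \<subseteq> S" using split[OF f(2)] by (simp add: f'_def c_def)
  have f'p: "Poly_Mapping.keys f' \<subseteq> paths (quiver \<Gamma>)" using keys[of f'] f' by blast
  have f'_span: "coset K f' \<in> basis_span K S" unfolding basis_span_def using f'
    by (intro imageI) simp
  have "c \<noteq> 0"
  proof
    assume "c = 0"
    then have "f' = f" by (simp add: f'_def)
    then show False using f'_span x(2) f(1) by simp
  qed
  have mem: "coset K (Poly_Mapping.single b d) \<in> N" for d
  proof -
    have "coset K f' \<in> N" using f'_span sub(1) by blast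
    then have "coset K (- f') \<in> N"
      using minus_coset[OF f'p, of K] additive_subgroup.a_inv_closed[OF Np(1), of "coset K f'"]
        by simp
    then have "x \<oplus>\<^bsub>?L\<^esub> coset K (- f') \<in> N" using x(1) additive_subgroup.a_closed[OF Np(1)] by simp
    moreover have "x \<oplus>\<^bsub>?L\<^esub> coset K (- f') = coset K (Poly_Mapping.single b c)"
    proof -
      have "Poly_Mapping.keys (- f') \<subseteq> paths (quiver \<Gamma>)" using f'p by simp
      moreover have "f + - f' = Poly_Mapping.single b c" by (simp add: f'_def)
      ultimately show ?thesis using add_coset[OF keys[OF f(2)], of "- f'" K] f(1) by simp
    qed
    ultimately have N1: "coset K (Poly_Mapping.single b c) \<in> N" by simp
    \<comment> \<open>Right multiplication by this multiple of the trivial path at the end of b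
      turns the coefficient c into d.\<close>
    let ?s = "Poly_Mapping.single (path_end (quiver \<Gamma>) b, []) (inverse c * d)"
    have s: "Poly_Mapping.keys ?s \<subseteq> paths (quiver \<Gamma>)"
      using quiver.path_end_in_verts[OF b] by (simp add: quiver.trivial_in_paths)
    have "coset K (Poly_Mapping.single b c) \<otimes>\<^bsub>?L\<^esub> coset K ?s \<in> N"
      using s by (intro Np(2) N1) (auto simp: carrier_brauer_algebra)
    moreover have "coset K (Poly_Mapping.single b c) \<otimes>\<^bsub>?L\<^esub> coset K ?s
      = coset K (Poly_Mapping.single b d)"
      using b s \<open>c \<noteq> 0\<close> by (subst mult_coset) (simp_all add: path_comp_def mult.assoc[symmetric])
    ultimately show ?thesis by simp
  qed
  have "basis_span K (insert b S) \<subseteq> N"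
  proof
    fix y assume "y \<in> basis_span K (insert b S)"
    then obtain g where g: "Poly_Mapping.keys g \<subseteq> insert b S" "y = coset K g"
      unfolding basis_span_def by blast
    let ?t = "Poly_Mapping.single b (Poly_Mapping.lookup g b)"
    have "coset K (g - ?t) \<in> basis_span K S"
      unfolding basis_span_def using split[OF g(1)] by (intro imageI) simp
    then have "coset K (g - ?t) \<in> N" using sub(1) by blast
    then have "coset K (g - ?t) \<oplus>\<^bsub>?L\<^esub> coset K ?t \<in> N"
      using mem additive_subgroup.a_closed[OF Np(1)] by blast
    moreover have "coset K (g - ?t) \<oplus>\<^bsub>?L\<^esub> coset K ?t = y"
      using keys[of "g - ?t"] split[OF g(1)] b g(2) by (subst add_coset) auto
    ultimately show "y \<in> N" by simp
  qed
  with sub(2) show ?thesis by blast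
qed

text \<open>One basis element is adjoined per step, from the empty segment with span 0 to the whole
  basis. The list has one term more than \<open>bs\<close>, matching the subtraction of 1 in
  \<open>right_module_length\<close>.\<close>

lemma composition_series_basis_span:
  assumes V: "V \<in> polygons \<Gamma>" and bs: "distinct bs" "set bs = basis V"
    and closed: "\<And>k. path_closed (set (take k bs))"
  shows "composition_series (brauer_algebra K \<Gamma>) (principal_right_module (brauer_algebra K \<Gamma>)
    (vertex_idem K \<Gamma> V))
    (map (\<lambda>k. basis_span K (set (take k bs))) [0..<Suc (length bs)])"
    (is "composition_series ?L ?M ?Ns")
proof -
  have sub: "set (take k bs) \<subseteq> basis V" for k using bs(2) set_take_subset[of k bs] by simp
  have "hd ?Ns = {\<zero>\<^bsub>?M\<^esub>}"
    by (simp add: hd_map basis_span_def zero_coset del: upt_Suc)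
  moreover have "last ?Ns = carrier ?M"
    using carrier_projective[OF V, of K] bs(2) by simp
  moreover have "right_submodule ?L ?M N" if "N \<in> set ?Ns" for N
    using that right_submodule_basis_span[OF V sub closed, of K] by (auto simp del: upt_Suc)
  moreover have "?Ns ! i \<subset> ?Ns ! Suc i \<and> \<not> (\<exists>N. right_submodule ?L ?M N \<and> ?Ns ! i \<subset> N
    \<and> N \<subset> ?Ns ! Suc i)"
    if i: "Suc i < length ?Ns" for i
  proof -
    have i': "i < length bs" using i by simp
    let ?S = "set (take i bs)" and ?b = "bs ! i"
    have ins: "set (take (Suc i) bs) = insert ?b ?S" using i' by (simp add: take_Suc_conv_app_nth)
    have nth: "?Ns ! i = basis_span K ?S" "?Ns ! Suc i = basis_span K (insert ?b ?S)"
      using i' ins by (simp_all del: upt_Suc)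
    have "?b \<notin> ?S"
      using bs(1) i' by (auto simp: in_set_conv_nth nth_eq_iff_index_eq)
    moreover have b: "insert ?b ?S \<subseteq> basis V" using sub[of "Suc i"] ins by simp
    ultimately have "coset K (path_elt (fst ?b) (snd ?b)) \<notin> basis_span K ?S"
      by (subst coset_in_basis_span_iff[of _ V]) auto
    moreover have "coset K (path_elt (fst ?b) (snd ?b)) \<in> basis_span K (insert ?b ?S)"
      unfolding basis_span_def by auto
    moreover have "basis_span K ?S \<subseteq> basis_span K (insert ?b ?S)" unfolding basis_span_def by blast
    ultimately have "basis_span K ?S \<subset> basis_span K (insert ?b ?S)" by blast
    then show ?thesis
      using basis_span_insert_simple[OF V b] unfolding nth by blast
  qed
  ultimately show ?thesis
    unfolding composition_series_def by simp
qed

section \<open>Counting and ordering the basis\<close>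

text \<open>The lengths stop strictly below val(\<alpha>)mu(\<alpha>), since every run of exactly
  that length has the single representative \<open>full_rep\<close> as normal form.\<close>

lemma basis_eq:
  assumes V: "V \<in> polygons \<Gamma>"
  shows "basis V = insert (V, []) (insert (V, full_rep \<Gamma> V) ((\<lambda>(\<alpha>, j, n). (V, run \<Gamma> \<alpha> j n)) `
    (SIGMA \<alpha>:nontruncated \<Gamma> \<inter> set_mset (polygon \<Gamma> V). {j. j < valence \<Gamma> \<alpha> \<and> successors \<Gamma> \<alpha> ! j
      = V} \<times>
       {1..<valence \<Gamma> \<alpha> * mu \<Gamma> \<alpha>})))" (is "_ = ?B")
proof
  show "basis V \<subseteq> ?B"
  proof
    fix p assume p: "p \<in> basis V"
    then obtain as where as: "p = (V, as)" "(V, as) \<in> paths (quiver \<Gamma>)" "normal_form \<Gamma> (V, as)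
      = Some (V, as)"
      by (cases p) (auto simp: basis_def)
    consider "as = []" | "as = full_rep \<Gamma> V" | "as \<noteq> []" "successively (cyc_next \<Gamma>) as" "length as <
      run_bound \<Gamma> as"
      using as(3) by (force simp: normal_form_def zero_path_def full_path_def split: if_splits)
    then show "p \<in> ?B"
    proof cases
      case 3
      obtain \<alpha> j where run: "\<alpha> \<in> nontruncated \<Gamma>" "j < valence \<Gamma> \<alpha>" "V = successors \<Gamma> \<alpha> ! j"
        "as = run \<Gamma> \<alpha> j (length as)" "run_bound \<Gamma> as = valence \<Gamma> \<alpha> * mu \<Gamma> \<alpha>"
        using path_runE[OF as(2) 3(1,2)] by metis
      have "p = (\<lambda>(\<alpha>, j, n). (V, run \<Gamma> \<alpha> j n)) (\<alpha>, j, length as)" using as(1) run(4) by simp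
      moreover have "1 \<le> length as" using 3(1) by (simp add: Suc_leI)
      ultimately show ?thesis
        using run(1,2,3,5) 3(3) successors_eq_imp_mem[OF run(1,2)]
        by (intro insertI2 image_eqI[where x = "(\<alpha>, j, length as)"]) simp_all
    qed (use as in auto)
  qed
  show "?B \<subseteq> basis V"
    using V full_rep[OF V] run_in_paths
    by (auto simp: basis_def normal_form_def zero_path_def full_path_def quiver.trivial_in_paths
        successively_run run_bound_run)
qed

lemma card_successors_eq:
  assumes "\<alpha> \<in> nontruncated \<Gamma>" "V \<in> polygons \<Gamma>"
  shows "card {j. j < valence \<Gamma> \<alpha> \<and> successors \<Gamma> \<alpha> ! j = V} = occ \<Gamma> \<alpha> V"
  using successors_occ[OF assms] length_successors[OF assms(1)]
  by (simp add: count_list_eq_length_filter length_filter_conv_card eq_commute)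

lemma
  assumes V: "V \<in> polygons \<Gamma>"
  shows finite_basis: "finite (basis V)"
    and card_basis: "card (basis V) = 2 + (\<Sum>\<alpha>\<in>set_mset (polygon \<Gamma> V). occ \<Gamma> \<alpha> V * (valence \<Gamma> \<alpha> * mu
      \<Gamma> \<alpha> - 1))"
proof -
  let ?N = "nontruncated \<Gamma> \<inter> set_mset (polygon \<Gamma> V)"
  let ?J = "\<lambda>\<alpha>. {j. j < valence \<Gamma> \<alpha> \<and> successors \<Gamma> \<alpha> ! j = V} \<times> {1..<valence \<Gamma> \<alpha> * mu \<Gamma> \<alpha>}"
  let ?f = "\<lambda>(\<alpha>, j, n). (V, run \<Gamma> \<alpha> j n)"
  let ?D = "SIGMA \<alpha>:?N. ?J \<alpha>"
  have fin: "finite ?D" by (intro finite_SigmaI) auto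
  then show "finite (basis V)" unfolding basis_eq[OF V] by simp
  \<comment> \<open>The number of arrows recovers n, and the first arrow recovers the pair of
    \<alpha> and j.\<close>
  have inj: "inj_on ?f ?D"
  proof (rule inj_onI; clarsimp)
    fix \<alpha> j n \<beta> i m
    assume eq: "run \<Gamma> \<alpha> j n = run \<Gamma> \<beta> i m" and *: "Suc 0 \<le> n" "Suc 0 \<le> m" "j < valence \<Gamma> \<alpha>" "i <
      valence \<Gamma> \<beta>"
    have "n = m" using arg_cong[OF eq, of length] by simp
    moreover have "(\<alpha>, j) = (\<beta>, i)" using arg_cong[OF eq, of hd] * by (simp add: hd_run)
    ultimately show "\<alpha> = \<beta> \<and> j = i \<and> n = m" by simp
  qed
  have notin: "(V, full_rep \<Gamma> V) \<notin> ?f ` ?D" "(V, []) \<notin> insert (V, full_rep \<Gamma> V) (?f ` ?D)"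
    using full_rep(2)[OF V] by (auto simp: full_path_def run_bound_run)
  have "card (?f ` ?D) = (\<Sum>\<alpha>\<in>?N. card (?J \<alpha>))"
    by (subst card_image[OF inj], subst card_SigmaI) auto
  also have "\<dots> = (\<Sum>\<alpha>\<in>?N. occ \<Gamma> \<alpha> V * (valence \<Gamma> \<alpha> * mu \<Gamma> \<alpha> - 1))"
    by (intro sum.cong refl) (simp add: card_cartesian_product card_successors_eq[OF _ V])
  \<comment> \<open>The vertices added to the range are truncated, and their summands vanish because
    valence and multiplicity are both 1.\<close>
  also have "\<dots> = (\<Sum>\<alpha>\<in>set_mset (polygon \<Gamma> V). occ \<Gamma> \<alpha> V * (valence \<Gamma> \<alpha> * mu \<Gamma> \<alpha> - 1))"
    by (intro sum.mono_neutral_left) (auto simp: nontruncated_def truncated_def dest: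
      mem_vertices[OF V])
  finally show "card (basis V) = 2 + (\<Sum>\<alpha>\<in>set_mset (polygon \<Gamma> V). occ \<Gamma> \<alpha> V * (valence \<Gamma> \<alpha> * mu \<Gamma> \<alpha> -
    1))"
    unfolding basis_eq[OF V] using fin notin by simp
qed

text \<open>A trivial q leaves p unchanged. A nontrivial q kills the full representative; any other
  basis path is killed, completed to a full path and so sent to the representative, or properly
  lengthened.\<close>

lemma basis_comp:
  assumes p: "p \<in> basis V" and q: "q \<in> paths (quiver \<Gamma>)"
    and r: "Option.bind (path_comp (quiver \<Gamma>) p q) (normal_form \<Gamma>) = Some r"
  shows "r \<in> basis V" and "r = p \<or> r = (V, full_rep \<Gamma> V) \<or> snd p \<noteq> full_rep \<Gamma> V
    \<and> length (snd p) < length (snd r)"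
proof -
  obtain s where s: "path_comp (quiver \<Gamma>) p q = Some s" "normal_form \<Gamma> s = Some r"
    using r by (auto simp: bind_eq_Some_conv)
  have pV: "p \<in> paths (quiver \<Gamma>)" "fst p = V" "normal_form \<Gamma> p = Some p" using p
    by (auto simp: basis_def)
  have sp: "s \<in> paths (quiver \<Gamma>)" by (rule quiver.path_comp_in_paths[OF pV(1) q s(1)])
  have s_eq: "s = (V, snd p @ snd q)" using s(1) pV(2)
    by (auto simp: path_comp_def split: if_splits)
  show "r \<in> basis V"
    using normal_form_in_paths[OF sp s(2)] path_end_normal_form(2)[OF sp s(2)] normal_form_idem[OF
      sp s(2)] s_eq
    by (simp add: basis_def)
  show "r = p \<or> r = (V, full_rep \<Gamma> V) \<or> snd p \<noteq> full_rep \<Gamma> V \<and> length (snd p) < length (snd r)"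
  proof (cases "snd q = []")
    case True
    then have "s = p" using s_eq pV(2) by (simp add: prod_eq_iff)
    then show ?thesis using s(2) pV(3) by simp
  next
    case False
    have V: "V \<in> polygons \<Gamma>" using quiver.fst_path_in_verts[OF pV(1)] pV(2) by simp
    have "snd p \<noteq> full_rep \<Gamma> V"
    proof
      assume "snd p = full_rep \<Gamma> V"
      then have "zero_path \<Gamma> (snd s)"
        using zero_path_append_full[of \<Gamma> "snd p" "snd q"] full_rep(2)[OF V] False s_eq by simp
      then show False using s(2) by (simp add: normal_form_def)
    qed
    then show ?thesis
      using s(2) False s_eq by (auto simp: normal_form_def split: if_splits)
  qed
qed

lemma basis_list:
  assumes V: "V \<in> polygons \<Gamma>"
  obtains bs where "distinct bs" "set bs = basis V" "\<And>k. path_closed (set (take k bs))"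
proof -
  obtain xs where xs: "set xs = basis V" "distinct xs"
    using finite_distinct_list[OF finite_basis[OF V]] by blast
  define L where "L = Max ((\<lambda>p. length (snd p)) ` basis V)"
  \<comment> \<open>The representative needs the least key 0 of its own: vertices of V may have
    different values val(\<alpha>)mu(\<alpha>), so it can be shorter than the path that is completed
    to it. The successor keeps all other keys positive, and the maximal length L makes the truncated
    subtraction strictly decreasing in the length.\<close>
  define h where "h p = (if snd p = full_rep \<Gamma> V then 0 else Suc (L - length (snd p)))"
    for p :: "('l, 'a \<times> nat) path"
  have L: "length (snd p) \<le> L" if "p \<in> basis V" for p
    unfolding L_def using that finite_basis[OF V] by (intro Max_ge) auto
  have "path_closed (set (take k (sort_key h xs)))" for k
    unfolding path_closed_def
  proof (intro ballI allI impI)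
    fix p q r
    assume p: "p \<in> set (take k (sort_key h xs))" and q: "q \<in> paths (quiver \<Gamma>)"
      and r: "Option.bind (path_comp (quiver \<Gamma>) p q) (normal_form \<Gamma>) = Some r"
    have pb: "p \<in> basis V" using p xs(1) by (metis in_set_takeD set_sort)
    note rb = basis_comp[OF pb q r]
    have "r = p \<or> h r < h p"
      using rb L[OF rb(1)] pb by (auto simp: h_def basis_def prod_eq_iff)
    then show "r \<in> set (take k (sort_key h xs))"
      using p in_set_take_sort_key[OF p, of r] rb(1) xs(1) by blast
  qed
  then show ?thesis using that[of "sort_key h xs"] xs by simp
qed

end

theorem corollary4p6:
  fixes \<Gamma> :: "('a, 'l) brauer_config" and V :: 'l
  assumes "brauer_configuration \<Gamma>" and "V \<in> polygons \<Gamma>"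
  shows "right_module_length (brauer_algebra TYPE('k::field) \<Gamma>)
           (principal_right_module (brauer_algebra TYPE('k) \<Gamma>) (vertex_idem TYPE('k) \<Gamma> V))
         = enat (2 + (\<Sum>\<alpha>\<in>set_mset (polygon \<Gamma> V).
                        occ \<Gamma> \<alpha> V * (valence \<Gamma> \<alpha> * mu \<Gamma> \<alpha> - 1)))"
proof -
  interpret brauer_configuration \<Gamma> by (rule assms(1))
  obtain bs where bs: "distinct bs" "set bs = basis V" "\<And>k. path_closed (set (take k bs))"
    using basis_list[OF assms(2)] by blast
  interpret M: right_module "brauer_algebra TYPE('k) \<Gamma>"
      "principal_right_module (brauer_algebra TYPE('k) \<Gamma>) (vertex_idem TYPE('k) \<Gamma> V)"
    by (rule ring.right_module_principal[OF ring_brauer_algebra vertex_idem_carrier[OF assms(2)]])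
  show ?thesis
    using M.right_module_length_eq[OF composition_series_basis_span[OF assms(2) bs]]
      distinct_card[OF bs(1)] bs(2) card_basis[OF assms(2)] by simp
qed

end
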